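(* Let $R$ be an equivalence relation on $V(\mathscr{X})$, let $e\in E(\mathscr{X})$ with $e//R\in E(\mathscr{X}/R)$, and let $\mathcal{X}\subseteq\mathscr{X}$ be both $\widetilde{e}$-closed for addition and $\widetilde{e}$-amenable for addition. Let $\pi_{\widetilde{e}}\colon\mathcal{X}\to\mathscr{X}$ be the equivalent-hyperedges addition partial transformation, i.e. $\pi_{\widetilde{e}}(X)=X\boxplus\widetilde{e}_X$ if $\widetilde{e}_X\neq\emptyset$ and $\widetilde{e}_X\cap E(X)=\emptyset$, and $\pi_{\widetilde{e}}(X)=X$ otherwise. Define $$\widetilde{\mathcal{S}}:=\{\,S\in\mathcal{X}\mid\widetilde{e}_S\neq\emptyset,\ \widetilde{e}_S\cap E(S)=\emptyset,\text{ and }S=S\wedge\widetilde{e}_S\,\},$$ and for $X\in\mathcal{X}$ define $\widetilde{\mathcal{D}}_X:=\{X\wedge\widetilde{e}_X\}$ when $\widetilde{e}_X\neq\emptyset$ and $\widetilde{e}_X\cap E(X)=\emptyset$, and $\widetilde{\mathcal{D}}_X:=\emptyset$ otherwise. Also let $$\mathcal{S}^+:=\{\,T\in\mathcal{X}/R\mid e//R\subseteq V(T),\ e//R\notin E(T),\text{ and }T=T\wedge e//R\,\}.$$ Then: (1) $\mathcal{T}_{\widetilde{e}}:=(\mathcal{X},\pi_{\widetilde{e}},\widetilde{\mathcal{S}})$ is a hypergraph transformation on $\mathscr{X}$ with $\widetilde{\mathcal{S}}$-maximal subsets $\{\widetilde{\mathcal{D}}_X\}_{X\in\mathcal{X}}$.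 (2) If $R$ is $\widetilde{\mathcal{S}}$-preserving with respect to $\mathcal{X}$ then $\mathcal{T}^+_{e//R}:=(\mathcal{X}/R,\pi^+_{e//R},\mathcal{S}^+)$ is a hyperedge addition hypergraph transformation on $\mathscr{X}/R$ for the hyperedge $e//R$, where for $X//R\in\mathcal{X}/R$ the $\mathcal{S}^+$-maximal subsets are $\mathcal{D}^+_{X//R}=\{X//R\wedge e//R\}$ if $e//R\subseteq V(X//R)$ and $e//R\notin E(X//R)$, and $\mathcal{D}^+_{X//R}=\emptyset$ if $e//R\nsubseteq V(X//R)$ or $e//R\in E(X//R)$. (3) $\widetilde{\mathcal{S}}/R$ is upward closed with respect to $\mathcal{S}^+$. (4) If $R$ is $\widetilde{\mathcal{S}}$-preserving with respect to $\mathcal{X}$ then $\mathcal{T}_{\widetilde{e}}$ is amenable with respect to $R$. In particular, the hypergraph transformation $\mathcal{T}_{\widetilde{e}}/R:=(\mathcal{X}/R,\pi_{\widetilde{e}}/R,\widetilde{\mathcal{S}}/R)$ is the support reduction of $\mathcal{T}^+_{e//R}$ corresponding to $\widetilde{\mathcal{S}}/R$.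
   Context: Hypergraphs. Fix a nonempty set $L_V$ of vertices (vertices are identified with their labels) and a set $\mathbb{E}$ of labelled hyperedges: each $e\in\mathbb{E}$ has an underlying nonempty finite subset of $L_V$, also written $e$; every nonempty finite subset of $L_V$ (of size $\ge 2$ if loops are disallowed) underlies at least one and only finitely many elements of $\mathbb{E}$, so multiple hyperedges are allowed. Loops ($|e|=1$) are either allowed throughout or disallowed throughout. A hypergraph is a pair $X=(V(X),E(X))$ with $V(X)\subseteq L_V$ finite, $E(X)\subseteq\mathbb{E}$ finite, and $e\subseteq V(X)$ for all $e\in E(X)$. Let $\mathscr{X}$ be the set of all hypergraphs (the hypergraph family), $V(\mathscr{X})=L_V$, $E(\mathscr{X})=\mathbb{E}$, and let $\mathcal{N}$ be the null hypergraph (no vertices). A hypergraph is connected if it is nonnull and any two vertices are joined by a path; $\mathcal{C}(X)$ denotes the set of connected components of $X$ (maximal connected subhypergraphs), so $\mathcal{C}(\mathcal{N})=\emptyset$. $X,Y$ are (vertex) disjoint if $V(X)\cap V(Y)=\emptyset$, and component disjoint if $\mathcal{C}(X)\cap\mathcal{C}(Y)=\emptyset$. For pairwise disjoint hypergraphs, the direct sum $\bigoplus_i X_i$ has vertex set $\bigcup_i V(X_i)$ and hyperedge set $\bigcup_i E(X_i)$; the empty direct sum is $\mathcal{N}$. If $X=Y\oplus Z$ with $Y,Z$ disjoint, the direct difference is $X\ominus Z:=Y$ (it is defined exactly when $\mathcal{C}(Z)\subseteq\mathcal{C}(X)$). Component maximality. For $\mathcal{S}\subseteq\mathcal{X}\subseteq\mathscr{X}$,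 $\mathcal{S}$ is component maximal in $\mathcal{X}$ if for each $X\in\mathcal{X}$ there is a subset $\mathcal{D}_X\subseteq\mathcal{S}$, called an $\mathcal{S}$-maximal subset, such that: (1) $\mathcal{D}_X$ is pairwise component disjoint; (2) if $\mathcal{N}\in\mathcal{S}$ then $\mathcal{N}\in\mathcal{D}_X$; (3) $\mathcal{C}(T)\subseteq\mathcal{C}(X)$ for all $T\in\mathcal{D}_X$; (4) if $S\in\mathcal{S}$ and $\mathcal{C}(S)\subseteq\mathcal{C}(X)$ then there is $T\in\mathcal{D}_X$ with $\mathcal{C}(S)\subseteq\mathcal{C}(T)$. (Such $\mathcal{D}_X$ is unique.) Hypergraph transformation. A partial transformation on $\mathscr{X}$ is a map $\pi\colon\mathcal{X}\to\mathscr{X}$ with $\mathcal{X}\subseteq\mathscr{X}$. A hypergraph transformation on $\mathscr{X}$ is a triple $(\mathcal{X},\pi,\mathcal{S})$ with $\pi\colon\mathcal{X}\to\mathscr{X}$ a partial transformation and $\mathcal{S}\subseteq\mathcal{X}$ (the distinguished hypergraphs) such that: (1) $\mathcal{C}(S)\cap\mathcal{C}(\pi(S))=\emptyset$ for all $S\in\mathcal{S}$, and if $\mathcal{N}\in\mathcal{S}$ then $\pi(\mathcal{N})\ne\mathcal{N}$ (nonredundancy); (2) $\mathcal{S}$ is component maximal in $\mathcal{X}$, with $\mathcal{S}$-maximal subsets $\{\mathcal{D}_X\}_{X\in\mathcal{X}}$; (3) for each $X\in\mathcal{X}$, with $\mathcal{S}_X:=\{S\in\mathcal{D}_X\mid V(\pi(S))\cap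 V(X\ominus S)=\emptyset\}$, the set $\pi(\mathcal{S}_X)$ consists of pairwise vertex-disjoint hypergraphs, $|\pi(\mathcal{S}_X)|=|\mathcal{S}_X|$, and $\pi(X)=\overline{X}\oplus\bigoplus_{S\in\mathcal{S}_X}\pi(S)$ where $\overline{X}:=X\ominus\bigoplus_{S\in\mathcal{S}_X}S$. Support reduction. A subset $\mathcal{S}'\subseteq\mathcal{S}$ is upward closed with respect to $\mathcal{S}$ if $S\in\mathcal{S}'$, $T\in\mathcal{S}$ and $\mathcal{C}(S)\subseteq\mathcal{C}(T)$ imply $T\in\mathcal{S}'$ (in particular, being upward closed with respect to $\mathcal{S}$ includes $\mathcal{S}'\subseteq\mathcal{S}$). A hypergraph transformation $(\mathcal{X},\pi',\mathcal{S}')$ is a support reduction of the hypergraph transformation $(\mathcal{X},\pi,\mathcal{S})$ corresponding to $\mathcal{S}'$ if $\mathcal{S}'\subseteq\mathcal{S}$, $\mathcal{S}'$ is upward closed with respect to $\mathcal{S}$, and $\pi'|_{\mathcal{S}'}=\pi|_{\mathcal{S}'}$. Hyperedge notation. For a nonempty set $H$ of hyperedges and $X$ with $\bigcup H\subseteq V(X)$, $X\boxplus H$ is the hypergraph with vertex set $V(X)$ and hyperedge set the symmetric difference of $E(X)$ and $H$. For a set $H$ of hyperedges, $X\wedge H$ is the union of all $C\in\mathcal{C}(X)$ such that $e\cap V(C)\neq\emptyset$ for some $e\in H$. For a single hyperedge $h$, write $X\wedge h$ and $X\boxplus h$ for $X\wedge\{h\}$ and $X\boxplus\{h\}$. The hyperedge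 addition partial transformation $\pi^+_h$ for a hyperedge $h$ sends $X$ to $X\boxplus h$ if $h\subseteq V(X)$ and $h\notin E(X)$, and to $X$ otherwise; a hypergraph transformation whose partial transformation is $\pi^+_h$ is a hyperedge addition hypergraph transformation for $h$. Quotients. Let $R$ be an equivalence relation on $V(\mathscr{X})$ with classes $[v]_R$. For $X\in\mathscr{X}$, the vertex-augmented quotient hypergraph $X//R$ has vertex set $\{[v]_R\mid v\in V(X)\}$, and its hyperedges are the sets $\{[v_1]_R,\dots,[v_n]_R\}$ of classes ($n\ge1$, resp. $n\ge 2$ if loops are disallowed) for which there is $e\in E(X)$ with $e\cap[v_i]_R\ne\emptyset$ for all $i$ and $e\subseteq\bigcup_i[v_i]_R$ (quotient hyperedges are plain sets of classes). For $\mathcal{Y}\subseteq\mathscr{X}$, $\mathcal{Y}/R:=\{Y//R\mid Y\in\mathcal{Y}\}$. The family $\mathscr{X}/R$ is itself regarded as a hypergraph family, with all notions above applied to it. Amenability. Let $\mathcal{T}=(\mathcal{X},\pi,\mathcal{S})$ be a hypergraph transformation on $\mathscr{X}$ with $\mathcal{S}$-maximal subsets $\{\mathcal{D}_X\}$. Set $\mathcal{D}_X/R:=\{S//R\mid S\in\mathcal{D}_X\}$ (indexed by $X//R\in\mathcal{X}/R$), and $\pi/R\colon\mathcal{X}/R\to\mathscr{X}/R$, $(\pi/R)(X//R):=\pi(X)//R$. $\mathcal{T}$ is amenable with respect to $R$ if $\mathcal{T}/R:=(\mathcal{X}/R,\pi/R,\mathcal{S}/R)$ is a hypergraph transformation on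 $\mathscr{X}/R$; this includes that $\pi/R$ and the subsets $\mathcal{D}_X/R$ are well defined (depend only on $X//R$), the $\mathcal{D}_X/R$ being the $\mathcal{S}/R$-maximal subsets. Equivalent hyperedges. For $e\in E(\mathscr{X})$, $e//R:=\{[v]_R\mid v\in e\}$; the condition $e//R\in E(\mathscr{X}/R)$ means $|e//R|\ge2$ if loops are disallowed (and is automatic otherwise). $\widetilde{e}:=\{f\in E(\mathscr{X})\mid f//R=e//R\}$, and for $X\in\mathscr{X}$, $\widetilde{e}_X:=\{f\in\widetilde{e}\mid f\subseteq V(X)\}$. $\mathcal{X}$ is $\widetilde{e}$-closed for addition if $X\in\mathcal{X}$, $\widetilde{e}_X\neq\emptyset$ and $\widetilde{e}_X\cap E(X)=\emptyset$ imply $X\wedge\widetilde{e}_X\in\mathcal{X}$. $\mathcal{X}$ is $\widetilde{e}$-amenable for addition if for every $S\in\mathcal{X}$ with $\widetilde{e}_S\ne\emptyset$, $\widetilde{e}_S\cap E(S)=\emptyset$ and $S=S\wedge\widetilde{e}_S$ we have $\mathcal{C}(S)\nsubseteq\mathcal{C}(X)$ for all $X\in\mathcal{X}$ with $\widetilde{e}_X\cap E(X)\ne\emptyset$. For $\mathcal{S}\subseteq\mathcal{X}$, $R$ is $\mathcal{S}$-preserving with respect to $\mathcal{X}$ if $\mathcal{C}(S)\subseteq\mathcal{C}(X)$ implies $\mathcal{C}(S//R)\subseteq\mathcal{C}(X//R)$ for all $S\in\mathcal{S}$ and $X\in\mathcal{X}$. *)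

theory Defs
  imports Main
begin

section \<open>Hypergraph families and hypergraphs\<close>

text \<open>
  A hyperedge is a label of type \<open>'e\<close>; its underlying vertex set is \<open>ends F e\<close>.
  The flag \<open>loops F\<close> records whether loops are allowed throughout.
\<close>

record ('v, 'e) hfam =
  vlabels :: "'v set"
  elabels :: "'e set"
  ends :: "'e \<Rightarrow> 'v set"
  loops :: bool

definition edge_sets :: "'v set \<Rightarrow> bool \<Rightarrow> 'v set set" where
  "edge_sets L l = {A. A \<subseteq> L \<and> finite A \<and> A \<noteq> {} \<and> (l \<or> 2 \<le> card A)}"

definition hypergraph_family :: "('v, 'e) hfam \<Rightarrow> bool" where
  "hypergraph_family F \<longleftrightarrow>
     vlabels F \<noteq> {} \<and>
     (\<forall>e\<in>elabels F. ends F e \<in> edge_sets (vlabels F) (loops F)) \<and>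
     (\<forall>A\<in>edge_sets (vlabels F) (loops F).
        {e \<in> elabels F. ends F e = A} \<noteq> {} \<and> finite {e \<in> elabels F. ends F e = A})"

datatype ('v, 'e) hgraph = HGraph (V: "'v set") (E: "'e set")

definition hypergraphs :: "('v, 'e) hfam \<Rightarrow> ('v, 'e) hgraph set" where
  "hypergraphs F = {X. V X \<subseteq> vlabels F \<and> finite (V X) \<and> E X \<subseteq> elabels F \<and> finite (E X) \<and>
                       (\<forall>e\<in>E X. ends F e \<subseteq> V X)}"

definition null_hgraph :: "('v, 'e) hgraph" where
  "null_hgraph = HGraph {} {}"

definition subhgraph :: "('v, 'e) hgraph \<Rightarrow> ('v, 'e) hgraph \<Rightarrow> bool" where
  "subhgraph Y X \<longleftrightarrow> V Y \<subseteq> V X \<and> E Y \<subseteq> E X"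

definition adjacency :: "('v, 'e) hfam \<Rightarrow> ('v, 'e) hgraph \<Rightarrow> ('v \<times> 'v) set" where
  "adjacency F X = {(u, v). \<exists>e\<in>E X. u \<in> ends F e \<and> v \<in> ends F e}"

definition connected_hgraph :: "('v, 'e) hfam \<Rightarrow> ('v, 'e) hgraph \<Rightarrow> bool" where
  "connected_hgraph F X \<longleftrightarrow>
     V X \<noteq> {} \<and> (\<forall>u\<in>V X. \<forall>v\<in>V X. (u, v) \<in> (adjacency F X)\<^sup>*)"

definition components :: "('v, 'e) hfam \<Rightarrow> ('v, 'e) hgraph \<Rightarrow> ('v, 'e) hgraph set" where
  "components F X =
     {C \<in> hypergraphs F. subhgraph C X \<and> connected_hgraph F C \<and>
        (\<forall>C'\<in>hypergraphs F. subhgraph C' X \<and> connected_hgraph F C' \<and> subhgraph C C' \<longrightarrow> C' = C)}"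

definition vdisjoint :: "('v, 'e) hgraph \<Rightarrow> ('v, 'e) hgraph \<Rightarrow> bool" where
  "vdisjoint X Y \<longleftrightarrow> V X \<inter> V Y = {}"

definition component_disjoint ::
    "('v, 'e) hfam \<Rightarrow> ('v, 'e) hgraph \<Rightarrow> ('v, 'e) hgraph \<Rightarrow> bool" where
  "component_disjoint F X Y \<longleftrightarrow> components F X \<inter> components F Y = {}"

text \<open>
  The union of a set of hypergraphs, which is their direct sum \<open>\<Oplus>\<close> when the members are
  pairwise vertex disjoint.
\<close>

definition hUnion :: "('v, 'e) hgraph set \<Rightarrow> ('v, 'e) hgraph" where
  "hUnion \<A> = HGraph (\<Union>X\<in>\<A>. V X) (\<Union>X\<in>\<A>. E X)"

definition direct_sum :: "('v, 'e) hgraph \<Rightarrow> ('v, 'e) hgraph \<Rightarrow> ('v, 'e) hgraph" where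
  "direct_sum X Y = HGraph (V X \<union> V Y) (E X \<union> E Y)"

text \<open>Meaningful only if \<open>components F Z \<subseteq> components F X\<close>.\<close>

definition direct_diff ::
    "('v, 'e) hfam \<Rightarrow> ('v, 'e) hgraph \<Rightarrow> ('v, 'e) hgraph \<Rightarrow> ('v, 'e) hgraph" where
  "direct_diff F X Z = (THE Y. Y \<in> hypergraphs F \<and> vdisjoint Y Z \<and> X = direct_sum Y Z)"


section \<open>Hypergraph transformations\<close>

text \<open>
  \<open>maximal_subset F S X D\<close>: \<open>D\<close> is the \<open>S\<close>-maximal subset for \<open>X\<close>.
\<close>

definition maximal_subset ::
    "('v, 'e) hfam \<Rightarrow> ('v, 'e) hgraph set \<Rightarrow> ('v, 'e) hgraph \<Rightarrow> ('v, 'e) hgraph set \<Rightarrow> bool" where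
  "maximal_subset F S X D \<longleftrightarrow>
     D \<subseteq> S \<and>
     pairwise (component_disjoint F) D \<and>
     (null_hgraph \<in> S \<longrightarrow> null_hgraph \<in> D) \<and>
     (\<forall>T\<in>D. components F T \<subseteq> components F X) \<and>
     (\<forall>Y\<in>S. components F Y \<subseteq> components F X \<longrightarrow>
        (\<exists>T\<in>D. components F Y \<subseteq> components F T))"

text \<open>
  A partial transformation with domain \<open>\<X>\<close> is represented by a function on the whole type whose
  values outside \<open>\<X>\<close> are irrelevant; likewise for the family \<open>D\<close> of maximal subsets, indexed
  by \<open>\<X>\<close>.  \<open>active F p D X\<close> is the set \<open>S\<^sub>X\<close> of those members of \<open>D X\<close> that are actually
  transformed.
\<close>

definition active ::
    "('v, 'e) hfam \<Rightarrow> (('v, 'e) hgraph \<Rightarrow> ('v, 'e) hgraph) \<Rightarrow>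
     (('v, 'e) hgraph \<Rightarrow> ('v, 'e) hgraph set) \<Rightarrow> ('v, 'e) hgraph \<Rightarrow> ('v, 'e) hgraph set" where
  "active F p D X = {Y \<in> D X. V (p Y) \<inter> V (direct_diff F X Y) = {}}"

definition hypergraph_transformation_with ::
    "('v, 'e) hfam \<Rightarrow> ('v, 'e) hgraph set \<Rightarrow> (('v, 'e) hgraph \<Rightarrow> ('v, 'e) hgraph) \<Rightarrow>
     ('v, 'e) hgraph set \<Rightarrow> (('v, 'e) hgraph \<Rightarrow> ('v, 'e) hgraph set) \<Rightarrow> bool" where
  "hypergraph_transformation_with F \<X> p S D \<longleftrightarrow>
     \<X> \<subseteq> hypergraphs F \<and> p ` \<X> \<subseteq> hypergraphs F \<and> S \<subseteq> \<X> \<and>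
     (\<forall>Y\<in>S. component_disjoint F Y (p Y)) \<and>
     (null_hgraph \<in> S \<longrightarrow> p null_hgraph \<noteq> null_hgraph) \<and>
     (\<forall>X\<in>\<X>. maximal_subset F S X (D X)) \<and>
     (\<forall>X\<in>\<X>.
        pairwise vdisjoint (p ` active F p D X) \<and>
        card (p ` active F p D X) = card (active F p D X) \<and>
        p X = direct_sum (direct_diff F X (hUnion (active F p D X)))
                         (hUnion (p ` active F p D X)))"

definition hypergraph_transformation ::
    "('v, 'e) hfam \<Rightarrow> ('v, 'e) hgraph set \<Rightarrow> (('v, 'e) hgraph \<Rightarrow> ('v, 'e) hgraph) \<Rightarrow>
     ('v, 'e) hgraph set \<Rightarrow> bool" where
  "hypergraph_transformation F \<X> p S \<longleftrightarrow> (\<exists>D. hypergraph_transformation_with F \<X> p S D)"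

definition upward_closed ::
    "('v, 'e) hfam \<Rightarrow> ('v, 'e) hgraph set \<Rightarrow> ('v, 'e) hgraph set \<Rightarrow> bool" where
  "upward_closed F S' S \<longleftrightarrow>
     S' \<subseteq> S \<and>
     (\<forall>Y\<in>S'. \<forall>T\<in>S. components F Y \<subseteq> components F T \<longrightarrow> T \<in> S')"

text \<open>\<open>(\<X>, p', S')\<close> is the support reduction of \<open>(\<X>, p, S)\<close> corresponding to \<open>S'\<close>.\<close>

definition support_reduction ::
    "('v, 'e) hfam \<Rightarrow> ('v, 'e) hgraph set \<Rightarrow>
     (('v, 'e) hgraph \<Rightarrow> ('v, 'e) hgraph) \<Rightarrow> ('v, 'e) hgraph set \<Rightarrow>
     (('v, 'e) hgraph \<Rightarrow> ('v, 'e) hgraph) \<Rightarrow> ('v, 'e) hgraph set \<Rightarrow> bool" where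
  "support_reduction F \<X> p' S' p S \<longleftrightarrow>
     hypergraph_transformation F \<X> p' S' \<and>
     hypergraph_transformation F \<X> p S \<and>
     upward_closed F S' S \<and>
     (\<forall>Y\<in>S'. p' Y = p Y)"


section \<open>Hyperedge addition\<close>

definition boxplus :: "('v, 'e) hgraph \<Rightarrow> 'e set \<Rightarrow> ('v, 'e) hgraph" where
  "boxplus X H = HGraph (V X) (sym_diff (E X) H)"

definition meet_edges ::
    "('v, 'e) hfam \<Rightarrow> ('v, 'e) hgraph \<Rightarrow> 'e set \<Rightarrow> ('v, 'e) hgraph" where
  "meet_edges F X H = hUnion {C \<in> components F X. \<exists>h\<in>H. ends F h \<inter> V C \<noteq> {}}"

definition edge_add :: "('v, 'e) hfam \<Rightarrow> 'e \<Rightarrow> ('v, 'e) hgraph \<Rightarrow> ('v, 'e) hgraph" where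
  "edge_add F h X = (if ends F h \<subseteq> V X \<and> h \<notin> E X then boxplus X {h} else X)"

definition edge_addition_transformation_with ::
    "('v, 'e) hfam \<Rightarrow> 'e \<Rightarrow> ('v, 'e) hgraph set \<Rightarrow> (('v, 'e) hgraph \<Rightarrow> ('v, 'e) hgraph) \<Rightarrow>
     ('v, 'e) hgraph set \<Rightarrow> (('v, 'e) hgraph \<Rightarrow> ('v, 'e) hgraph set) \<Rightarrow> bool" where
  "edge_addition_transformation_with F h \<X> p S D \<longleftrightarrow>
     h \<in> elabels F \<and> hypergraph_transformation_with F \<X> p S D \<and> (\<forall>X\<in>\<X>. p X = edge_add F h X)"

definition edge_add_support ::
    "('v, 'e) hfam \<Rightarrow> 'e \<Rightarrow> ('v, 'e) hgraph set \<Rightarrow> ('v, 'e) hgraph set" where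
  "edge_add_support F h \<X> = {T \<in> \<X>. ends F h \<subseteq> V T \<and> h \<notin> E T \<and> T = meet_edges F T {h}}"

definition edge_add_maximal ::
    "('v, 'e) hfam \<Rightarrow> 'e \<Rightarrow> ('v, 'e) hgraph \<Rightarrow> ('v, 'e) hgraph set" where
  "edge_add_maximal F h T = (if ends F h \<subseteq> V T \<and> h \<notin> E T then {meet_edges F T {h}} else {})"


section \<open>Quotients and amenability\<close>

definition edge_quot :: "('v, 'e) hfam \<Rightarrow> ('v \<times> 'v) set \<Rightarrow> 'e \<Rightarrow> 'v set set" where
  "edge_quot F R e = ends F e // R"

text \<open>
  The quotient \<open>X//R\<close>.  Its vertices are classes and its hyperedges are plain sets of classes, so
  in \<open>quot_family\<close> each hyperedge is its own underlying set.
\<close>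

definition quot ::
    "('v, 'e) hfam \<Rightarrow> ('v \<times> 'v) set \<Rightarrow> ('v, 'e) hgraph \<Rightarrow> ('v set, 'v set set) hgraph" where
  "quot F R X = HGraph (V X // R)
     {A \<in> edge_sets (vlabels F // R) (loops F).
        \<exists>f\<in>E X. (\<forall>a\<in>A. ends F f \<inter> a \<noteq> {}) \<and> ends F f \<subseteq> \<Union>A}"

definition quot_family ::
    "('v, 'e) hfam \<Rightarrow> ('v \<times> 'v) set \<Rightarrow> ('v set, 'v set set) hfam" where
  "quot_family F R =
     \<lparr>vlabels = vlabels F // R, elabels = edge_sets (vlabels F // R) (loops F),
      ends = id, loops = loops F\<rparr>"

lemma quot_eq_image: "A // R = (\<lambda>v. R `` {v}) ` A"
  by (auto simp: quotient_def)

lemma hypergraph_family_quot: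
  assumes "hypergraph_family F"
  shows "hypergraph_family (quot_family F R)"
proof -
  have "{e \<in> edge_sets (vlabels F // R) (loops F). e = A} = {A}"
    if "A \<in> edge_sets (vlabels F // R) (loops F)" for A
    using that by auto
  then show ?thesis
    using assms by (auto simp: hypergraph_family_def quot_family_def quot_eq_image)
qed

text \<open>
  On sets of classes the membership condition in \<open>E (quot F R X)\<close> says that \<open>A = f//R\<close> for some
  \<open>f \<in> E X\<close>, and the quotients \<open>X//R\<close> are exactly the hypergraphs of \<open>quot_family F R\<close>.
\<close>

lemma edges_quot_iff:
  assumes R: "equiv (vlabels F) R" and L: "ends F f \<subseteq> vlabels F"
    and A: "A \<subseteq> vlabels F // R"
  shows "(\<forall>a\<in>A. ends F f \<inter> a \<noteq> {}) \<and> ends F f \<subseteq> \<Union>A \<longleftrightarrow> A = edge_quot F R f"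
proof
  assume H: "(\<forall>a\<in>A. ends F f \<inter> a \<noteq> {}) \<and> ends F f \<subseteq> \<Union>A"
  have cls: "a = R `` {v}" if "a \<in> A" "v \<in> a" for a v
    using that A R by (metis Image_singleton_iff equiv_class_eq in_mono quotientE)
  show "A = edge_quot F R f"
    unfolding edge_quot_def quot_eq_image
  proof (intro equalityI subsetI)
    fix a assume "a \<in> A"
    then obtain v where "v \<in> ends F f" "v \<in> a" using H by blast
    then show "a \<in> (\<lambda>v. R `` {v}) ` ends F f" using cls \<open>a \<in> A\<close> by blast
  next
    fix a assume "a \<in> (\<lambda>v. R `` {v}) ` ends F f"
    then obtain v where v: "v \<in> ends F f" "a = R `` {v}" by blast
    then obtain b where "b \<in> A" "v \<in> b" using H by blast
    then show "a \<in> A" using cls v by auto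
  qed
next
  assume A: "A = edge_quot F R f"
  have "v \<in> R `` {v}" if "v \<in> ends F f" for v
    using that L R by (meson equiv_class_self subsetD)
  then show "(\<forall>a\<in>A. ends F f \<inter> a \<noteq> {}) \<and> ends F f \<subseteq> \<Union>A"
    unfolding A edge_quot_def quot_eq_image by blast
qed

lemma hypergraphs_quot_family:
  fixes F :: "('v, 'e) hfam"
  assumes F: "hypergraph_family F" and R: "equiv (vlabels F) R"
  shows "hypergraphs (quot_family F R) = quot F R ` hypergraphs F"
proof (intro equalityI subsetI)
  fix Y assume Y: "Y \<in> hypergraphs (quot_family F R)"
  then have VY: "V Y \<subseteq> vlabels F // R" "finite (V Y)" "finite (E Y)"
    and EY: "\<And>A. A \<in> E Y \<Longrightarrow> A \<in> edge_sets (vlabels F // R) (loops F) \<and> A \<subseteq> V Y"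
    by (auto simp: hypergraphs_def quot_family_def)
  define s where "s a = (SOME v. v \<in> a)" for a :: "'v set"
  have s: "s a \<in> a \<and> s a \<in> vlabels F \<and> R `` {s a} = a" if "a \<in> vlabels F // R" for a
  proof -
    have "a \<noteq> {}" using that R in_quotient_imp_non_empty by blast
    then have 1: "s a \<in> a" unfolding s_def by (simp add: some_in_eq)
    moreover have "a \<subseteq> vlabels F" using that R in_quotient_imp_subset by blast
    moreover have "R `` {s a} = a"
      using that 1 R by (metis Image_singleton_iff equiv_class_eq quotientE)
    ultimately show ?thesis by blast
  qed
  have inj: "inj_on s A" if "A \<subseteq> vlabels F // R" for A
    using s that by (metis inj_onI subsetD)
  have "\<exists>f\<in>elabels F. ends F f = s ` A" if "A \<in> E Y" for A
  proof -
    have "s ` A \<in> edge_sets (vlabels F) (loops F)"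
      using EY[OF that] s inj by (force simp: edge_sets_def card_image)
    then show ?thesis using F unfolding hypergraph_family_def by blast
  qed
  then obtain g where g: "\<And>A. A \<in> E Y \<Longrightarrow> g A \<in> elabels F \<and> ends F (g A) = s ` A"
    by metis
  define X where "X = HGraph (s ` V Y) (g ` E Y)"
  have reps: "(s ` A) // R = A" if "A \<subseteq> vlabels F // R" for A
    unfolding quot_eq_image image_image using s that by (force simp: image_iff)
  have "X \<in> hypergraphs F"
    using VY EY g s unfolding X_def hypergraphs_def by fastforce
  moreover have "E (quot F R X) = E Y"
  proof -
    have "(\<exists>f\<in>g ` E Y. (\<forall>a\<in>A. ends F f \<inter> a \<noteq> {}) \<and> ends F f \<subseteq> \<Union>A) \<longleftrightarrow> A \<in> E Y"
      if "A \<in> edge_sets (vlabels F // R) (loops F)" for A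
    proof -
      have "(\<forall>a\<in>A. ends F (g B) \<inter> a \<noteq> {}) \<and> ends F (g B) \<subseteq> \<Union>A \<longleftrightarrow> A = B"
        if B: "B \<in> E Y" for B
      proof -
        have "ends F (g B) \<subseteq> vlabels F"
          using F g[OF B] by (auto simp: hypergraph_family_def edge_sets_def)
        moreover have "edge_quot F R (g B) = B"
          using reps EY[OF B] g[OF B] by (simp add: edge_quot_def edge_sets_def)
        ultimately show ?thesis
          using edges_quot_iff[OF R] \<open>A \<in> edge_sets _ _\<close> by (simp add: edge_sets_def)
      qed
      then show ?thesis by auto
    qed
    then show ?thesis using EY by (auto simp: quot_def X_def)
  qed
  moreover have "V (quot F R X) = V Y"
    using reps VY by (simp add: quot_def X_def)
  ultimately show "Y \<in> quot F R ` hypergraphs F"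
    by (metis hgraph.expand image_eqI)
next
  fix Y assume "Y \<in> quot F R ` hypergraphs F"
  then obtain X where X: "X \<in> hypergraphs F" "Y = quot F R X" by blast
  have sub: "A \<in> edge_sets (vlabels F // R) (loops F) \<and> A \<subseteq> V Y" if "A \<in> E Y" for A
  proof -
    have "A \<in> E (quot F R X)" using that X by simp
    then obtain f where f: "f \<in> E X" "(\<forall>a\<in>A. ends F f \<inter> a \<noteq> {}) \<and> ends F f \<subseteq> \<Union>A"
      and A: "A \<in> edge_sets (vlabels F // R) (loops F)"
      unfolding quot_def by auto
    have "ends F f \<subseteq> V X" "V X \<subseteq> vlabels F" using f X by (auto simp: hypergraphs_def)
    moreover have "A = edge_quot F R f"
      using edges_quot_iff[OF R] f A calculation by (metis (no_types, lifting) edge_sets_def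
        mem_Collect_eq order_trans)
    ultimately show ?thesis using A X by (auto simp: quot_def edge_quot_def quot_eq_image)
  qed
  have "finite (V Y)" "V Y \<subseteq> vlabels F // R"
    using X by (auto simp: quot_def hypergraphs_def quot_eq_image)
  moreover have "finite (E Y)"
    by (rule finite_subset[of _ "Pow (V Y)"]) (use sub calculation in auto)
  ultimately show "Y \<in> hypergraphs (quot_family F R)"
    using sub by (auto simp: hypergraphs_def quot_family_def)
qed

definition quot_map ::
    "('v, 'e) hfam \<Rightarrow> ('v \<times> 'v) set \<Rightarrow> ('v, 'e) hgraph set \<Rightarrow>
     (('v, 'e) hgraph \<Rightarrow> ('v, 'e) hgraph) \<Rightarrow>
     ('v set, 'v set set) hgraph \<Rightarrow> ('v set, 'v set set) hgraph" where
  "quot_map F R \<X> p Y = quot F R (p (inv_into \<X> (quot F R) Y))"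

definition quot_maximal ::
    "('v, 'e) hfam \<Rightarrow> ('v \<times> 'v) set \<Rightarrow> ('v, 'e) hgraph set \<Rightarrow>
     (('v, 'e) hgraph \<Rightarrow> ('v, 'e) hgraph set) \<Rightarrow>
     ('v set, 'v set set) hgraph \<Rightarrow> ('v set, 'v set set) hgraph set" where
  "quot_maximal F R \<X> D Y = quot F R ` D (inv_into \<X> (quot F R) Y)"

text \<open>
  \<open>quot_map\<close> and \<open>quot_maximal\<close> choose a preimage under \<open>X \<mapsto> X//R\<close>; the third conjunct
  below states that the result does not depend on this choice.
\<close>

definition amenable ::
    "('v, 'e) hfam \<Rightarrow> ('v \<times> 'v) set \<Rightarrow> ('v, 'e) hgraph set \<Rightarrow>
     (('v, 'e) hgraph \<Rightarrow> ('v, 'e) hgraph) \<Rightarrow> ('v, 'e) hgraph set \<Rightarrow>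
     (('v, 'e) hgraph \<Rightarrow> ('v, 'e) hgraph set) \<Rightarrow> bool" where
  "amenable F R \<X> p S D \<longleftrightarrow>
     equiv (vlabels F) R \<and>
     hypergraph_transformation_with F \<X> p S D \<and>
     (\<forall>X\<in>\<X>. \<forall>X'\<in>\<X>. quot F R X = quot F R X' \<longrightarrow>
        quot F R (p X) = quot F R (p X') \<and> quot F R ` D X = quot F R ` D X') \<and>
     hypergraph_transformation_with (quot_family F R) (quot F R ` \<X>)
       (quot_map F R \<X> p) (quot F R ` S) (quot_maximal F R \<X> D)"


section \<open>Equivalent hyperedges\<close>

definition equiv_edges :: "('v, 'e) hfam \<Rightarrow> ('v \<times> 'v) set \<Rightarrow> 'e \<Rightarrow> 'e set" where
  "equiv_edges F R e = {f \<in> elabels F. edge_quot F R f = edge_quot F R e}"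

definition equiv_edges_in ::
    "('v, 'e) hfam \<Rightarrow> ('v \<times> 'v) set \<Rightarrow> 'e \<Rightarrow> ('v, 'e) hgraph \<Rightarrow> 'e set" where
  "equiv_edges_in F R e X = {f \<in> equiv_edges F R e. ends F f \<subseteq> V X}"

definition closed_for_addition ::
    "('v, 'e) hfam \<Rightarrow> ('v \<times> 'v) set \<Rightarrow> 'e \<Rightarrow> ('v, 'e) hgraph set \<Rightarrow> bool" where
  "closed_for_addition F R e \<X> \<longleftrightarrow>
     (\<forall>X\<in>\<X>. equiv_edges_in F R e X \<noteq> {} \<and> equiv_edges_in F R e X \<inter> E X = {} \<longrightarrow>
        meet_edges F X (equiv_edges_in F R e X) \<in> \<X>)"

definition amenable_for_addition ::
    "('v, 'e) hfam \<Rightarrow> ('v \<times> 'v) set \<Rightarrow> 'e \<Rightarrow> ('v, 'e) hgraph set \<Rightarrow> bool" where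
  "amenable_for_addition F R e \<X> \<longleftrightarrow>
     (\<forall>S\<in>\<X>. equiv_edges_in F R e S \<noteq> {} \<and> equiv_edges_in F R e S \<inter> E S = {} \<and>
        S = meet_edges F S (equiv_edges_in F R e S) \<longrightarrow>
        (\<forall>X\<in>\<X>. equiv_edges_in F R e X \<inter> E X \<noteq> {} \<longrightarrow> \<not> components F S \<subseteq> components F X))"

definition preserving ::
    "('v, 'e) hfam \<Rightarrow> ('v \<times> 'v) set \<Rightarrow> ('v, 'e) hgraph set \<Rightarrow> ('v, 'e) hgraph set \<Rightarrow> bool" where
  "preserving F R S \<X> \<longleftrightarrow>
     (\<forall>Y\<in>S. \<forall>X\<in>\<X>. components F Y \<subseteq> components F X \<longrightarrow>
        components (quot_family F R) (quot F R Y) \<subseteq> components (quot_family F R) (quot F R X))"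

definition equiv_add ::
    "('v, 'e) hfam \<Rightarrow> ('v \<times> 'v) set \<Rightarrow> 'e \<Rightarrow> ('v, 'e) hgraph \<Rightarrow> ('v, 'e) hgraph" where
  "equiv_add F R e X =
     (if equiv_edges_in F R e X \<noteq> {} \<and> equiv_edges_in F R e X \<inter> E X = {}
      then boxplus X (equiv_edges_in F R e X) else X)"

definition equiv_add_support ::
    "('v, 'e) hfam \<Rightarrow> ('v \<times> 'v) set \<Rightarrow> 'e \<Rightarrow> ('v, 'e) hgraph set \<Rightarrow> ('v, 'e) hgraph set" where
  "equiv_add_support F R e \<X> =
     {S \<in> \<X>. equiv_edges_in F R e S \<noteq> {} \<and> equiv_edges_in F R e S \<inter> E S = {} \<and>
        S = meet_edges F S (equiv_edges_in F R e S)}"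

definition equiv_add_maximal ::
    "('v, 'e) hfam \<Rightarrow> ('v \<times> 'v) set \<Rightarrow> 'e \<Rightarrow> ('v, 'e) hgraph \<Rightarrow> ('v, 'e) hgraph set" where
  "equiv_add_maximal F R e X =
     (if equiv_edges_in F R e X \<noteq> {} \<and> equiv_edges_in F R e X \<inter> E X = {}
      then {meet_edges F X (equiv_edges_in F R e X)} else {})"

end

theory Submission
  imports Defs
begin

text \<open>
  Write \<open>\<A>\<close> for the set of hyperedges equivalent to \<open>e\<close> and \<open>h = e//R\<close>.  Both transformations of
  the theorem, the one on the family and the one on its quotient, are instances of one construction:
  given a set \<open>A\<close> of hyperedges, add to \<open>X\<close> all members of \<open>A\<close> that fit into \<open>V X\<close>, provided that
  there are some and that none is present yet (\<open>X\<close> is then called addable).  The quotient case is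
  \<open>A = {h}\<close>.  So one theorem, \<open>hypergraph_transformation_add_available\<close>, has to be proved, under
  closedness and amenability hypotheses on the domain.  It holds because the added hyperedges live
  inside the union \<open>S\<close> of the components that they meet: adding them changes \<open>S\<close> only, the vertex set
  of \<open>S\<close> stays the same, and every component of \<open>S\<close> gains a hyperedge and is hence destroyed.

  The bridge to the quotient is that \<open>X\<close> is addable for \<open>\<A>\<close> iff \<open>X//R\<close> is addable for \<open>{h}\<close>
  (\<open>addable_quot_iff\<close>), since every choice of representatives of the classes in \<open>h\<close> underlies a member
  of \<open>\<A>\<close>, and that paths descend to the quotient (\<open>reachable_quot\<close>), so that the quotient of a support
  member consists of components that meet \<open>h\<close> (\<open>quot_eq_meet_edges\<close>).

  In the quotient only one hyperedge is added, which makes supports rigid.  A support member contains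
  all vertices of \<open>h\<close>, and all its components meet \<open>h\<close>; so whenever its components are among those of
  \<open>T\<close>, it is the union of all components of \<open>T\<close> that meet \<open>h\<close> (\<open>Q_add_support_rigid\<close>).  Thus a
  support member contained componentwise in another one equals it, which gives upward closedness.
  Amenability for \<open>{h}\<close> is automatic, because a present \<open>h\<close> would lie in the common components.

  Finally, preservation of components by \<open>R\<close> lets the rigidity be applied to \<open>S//R\<close> and \<open>X//R\<close>, where
  \<open>S\<close> is the union of the components of \<open>X\<close> that meet the added hyperedges: it shows that \<open>S//R\<close> is
  the union of the components of \<open>X//R\<close> that meet \<open>h\<close> (\<open>quot_meet_edges\<close>).  Hence maximal subsets, supports and the
  transformation itself all commute with the quotient; the support reduction is in fact the whole
  transformation.
\<close>

section \<open>Components of a hypergraph\<close>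

locale hyperfamily =
  fixes F :: "('v, 'e) hfam"
  assumes family: "hypergraph_family F"
begin

lemma ends_nonempty: "f \<in> elabels F \<Longrightarrow> ends F f \<noteq> {}"
  using family by (auto simp: hypergraph_family_def edge_sets_def)

lemma edge_ends_nonempty: "X \<in> hypergraphs F \<Longrightarrow> f \<in> E X \<Longrightarrow> ends F f \<noteq> {}"
  using ends_nonempty by (auto simp: hypergraphs_def)

lemma edge_ends_subset: "X \<in> hypergraphs F \<Longrightarrow> f \<in> E X \<Longrightarrow> ends F f \<subseteq> V X"
  by (auto simp: hypergraphs_def)

lemma finite_edges_within:
  assumes "finite B" shows "finite {f \<in> elabels F. ends F f \<subseteq> B}"
proof -
  have "finite {f \<in> elabels F. ends F f = A}" for A
  proof (cases "A \<in> edge_sets (vlabels F) (loops F)")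
    case True
    then show ?thesis using family by (auto simp: hypergraph_family_def)
  next
    case False
    then have "{f \<in> elabels F. ends F f = A} = {}"
      using family by (auto simp: hypergraph_family_def)
    then show ?thesis by (metis finite.emptyI)
  qed
  then have "finite (\<Union>A\<in>Pow B. {f \<in> elabels F. ends F f = A})"
    using assms by blast
  moreover have "{f \<in> elabels F. ends F f \<subseteq> B} \<subseteq> (\<Union>A\<in>Pow B. {f \<in> elabels F. ends F f = A})"
    by blast
  ultimately show ?thesis by (rule rev_finite_subset)
qed

lemma sym_adjacency_rtrancl: "sym ((adjacency F X)\<^sup>*)"
  by (intro sym_rtrancl symI) (auto simp: adjacency_def)

lemma adjacency_mono: "E Y \<subseteq> E X \<Longrightarrow> adjacency F Y \<subseteq> adjacency F X"
  by (auto simp: adjacency_def)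

lemma reachable_in_V:
  assumes "X \<in> hypergraphs F" "v \<in> V X" "(v, w) \<in> (adjacency F X)\<^sup>*"
  shows "w \<in> V X"
  using assms(3,2) by (induction rule: rtrancl_induct)
    (use edge_ends_subset[OF assms(1)] in \<open>auto simp: adjacency_def\<close>)

text \<open>
  Components are defined by maximality among connected subhypergraphs.  This explicit form replaces
  the maximality by reachability.  A hyperedge belongs to it as soon as one of its ends does, as its
  other ends are then reachable too.
\<close>

definition component_of :: "('v, 'e) hgraph \<Rightarrow> 'v \<Rightarrow> ('v, 'e) hgraph" where
  "component_of X v = HGraph {w. (v, w) \<in> (adjacency F X)\<^sup>*}
     {f \<in> E X. \<exists>w\<in>ends F f. (v, w) \<in> (adjacency F X)\<^sup>*}"

lemma edge_of_component_of:
  assumes "f \<in> E X" "w \<in> ends F f" "w \<in> V (component_of X v)"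
  shows "f \<in> E (component_of X v)" "ends F f \<subseteq> V (component_of X v)"
proof -
  show "f \<in> E (component_of X v)" using assms by (auto simp: component_of_def)
  show "ends F f \<subseteq> V (component_of X v)"
  proof
    fix x assume "x \<in> ends F f"
    then have "(w, x) \<in> adjacency F X" using assms by (auto simp: adjacency_def)
    then show "x \<in> V (component_of X v)" using assms(3)
      by (auto simp: component_of_def intro: rtrancl_into_rtrancl)
  qed
qed

lemma self_in_component_of: "v \<in> V (component_of X v)"
  by (simp add: component_of_def)

lemma subhgraph_component_of:
  assumes "X \<in> hypergraphs F" "v \<in> V X"
  shows "subhgraph (component_of X v) X"
  using reachable_in_V[OF assms] by (auto simp: subhgraph_def component_of_def)

lemma component_of_in_hypergraphs:
  assumes "X \<in> hypergraphs F" "v \<in> V X"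
  shows "component_of X v \<in> hypergraphs F"
proof -
  have "ends F f \<subseteq> V (component_of X v)" if "f \<in> E (component_of X v)" for f
  proof -
    obtain w where "f \<in> E X" "w \<in> ends F f" "w \<in> V (component_of X v)"
      using \<open>f \<in> E (component_of X v)\<close> by (auto simp: component_of_def)
    then show ?thesis by (rule edge_of_component_of(2))
  qed
  then show ?thesis
    using subhgraph_component_of[OF assms] assms(1)
    by (auto simp: hypergraphs_def subhgraph_def intro: finite_subset)
qed

text \<open>
  Every hyperedge on a path from \<open>v\<close> has an end reachable from \<open>v\<close>, so the whole path stays inside the
  component.
\<close>

lemma connected_component_of: "connected_hgraph F (component_of X v)"
proof -
  let ?C = "component_of X v"
  have from_v: "(v, w) \<in> (adjacency F ?C)\<^sup>*" if "(v, w) \<in> (adjacency F X)\<^sup>*" for w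
    using that
  proof (induction rule: rtrancl_induct)
    case (step w x)
    then obtain f where f: "f \<in> E X" "w \<in> ends F f" "x \<in> ends F f"
      by (auto simp: adjacency_def)
    then have "f \<in> E ?C"
      using step by (intro edge_of_component_of(1)[of f X w]) (auto simp: component_of_def)
    then have "(w, x) \<in> adjacency F ?C" using f by (auto simp: adjacency_def)
    then show ?case using step by simp
  qed simp
  have "(u, w) \<in> (adjacency F ?C)\<^sup>*" if "u \<in> V ?C" "w \<in> V ?C" for u w
  proof -
    have "(v, u) \<in> (adjacency F ?C)\<^sup>*" "(v, w) \<in> (adjacency F ?C)\<^sup>*"
      using that from_v by (auto simp: component_of_def)
    then show ?thesis
      using sym_adjacency_rtrancl by (meson rtrancl_trans symD)
  qed
  then show ?thesis using self_in_component_of[of v X] by (auto simp: connected_hgraph_def)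
qed

lemma connected_subhgraph_component_of:
  assumes "C \<in> hypergraphs F" "subhgraph C X" "connected_hgraph F C" "v \<in> V C"
  shows "subhgraph C (component_of X v)"
proof -
  have "(adjacency F C)\<^sup>* \<subseteq> (adjacency F X)\<^sup>*"
    using assms(2) by (intro rtrancl_mono adjacency_mono) (simp add: subhgraph_def)
  then have reach: "(v, w) \<in> (adjacency F X)\<^sup>*" if "w \<in> V C" for w
    using assms(3,4) that by (auto simp: connected_hgraph_def)
  moreover have "\<exists>w\<in>ends F f. w \<in> V C" if "f \<in> E C" for f
    using edge_ends_nonempty[OF assms(1) that] edge_ends_subset[OF assms(1) that] by blast
  ultimately show ?thesis
    using assms(2) by (fastforce simp: subhgraph_def component_of_def)
qed

lemma subhgraph_antisym: "subhgraph X Y \<Longrightarrow> subhgraph Y X \<Longrightarrow> X = Y"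
  by (auto simp: subhgraph_def intro: hgraph.expand)

lemma component_eq:
  assumes X: "X \<in> hypergraphs F" and C: "C \<in> components F X" and v: "v \<in> V C"
  shows "C = component_of X v"
proof -
  have C': "C \<in> hypergraphs F" "subhgraph C X" "connected_hgraph F C"
    and max: "\<And>D. D \<in> hypergraphs F \<Longrightarrow> subhgraph D X \<Longrightarrow> connected_hgraph F D \<Longrightarrow>
                subhgraph C D \<Longrightarrow> D = C"
    using C by (auto simp: components_def)
  have "v \<in> V X" using C'(2) v by (auto simp: subhgraph_def)
  then show ?thesis
    using max[of "component_of X v"] component_of_in_hypergraphs[OF X]
      subhgraph_component_of[OF X] connected_component_of
      connected_subhgraph_component_of[OF C' v] by metis
qed

lemma components_eq:
  assumes X: "X \<in> hypergraphs F"
  shows "components F X = component_of X ` V X"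
proof (intro equalityI subsetI)
  fix C assume C: "C \<in> components F X"
  then obtain v where v: "v \<in> V C" "v \<in> V X"
    by (auto simp: components_def connected_hgraph_def subhgraph_def)
  then show "C \<in> component_of X ` V X" using component_eq[OF X C] by blast
next
  fix C assume "C \<in> component_of X ` V X"
  then obtain v where v: "v \<in> V X" "C = component_of X v" by blast
  have "D = C" if "D \<in> hypergraphs F" "subhgraph D X" "connected_hgraph F D" "subhgraph C D" for D
  proof -
    have "v \<in> V D" using that(4) v self_in_component_of by (auto simp: subhgraph_def)
    then show ?thesis
      using connected_subhgraph_component_of[OF that(1-3)] that(4) v subhgraph_antisym by blast
  qed
  then show "C \<in> components F X"
    using v component_of_in_hypergraphs[OF X] subhgraph_component_of[OF X] connected_component_of
    by (auto simp: components_def)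
qed

lemma components_hypergraphs: "components F X \<subseteq> hypergraphs F"
  by (auto simp: components_def)

lemma component_subhgraph: "C \<in> components F X \<Longrightarrow> subhgraph C X"
  by (auto simp: components_def)

lemma component_vertex: "C \<in> components F X \<Longrightarrow> \<exists>v. v \<in> V C"
  by (auto simp: components_def connected_hgraph_def)

lemma ex_component:
  assumes "X \<in> hypergraphs F" "v \<in> V X"
  shows "\<exists>C\<in>components F X. v \<in> V C"
  using assms self_in_component_of by (auto simp: components_eq)

lemma components_unique:
  assumes "X \<in> hypergraphs F" "C \<in> components F X" "D \<in> components F X" "v \<in> V C" "v \<in> V D"
  shows "C = D"
  using assms component_eq by metis

lemma component_edge:
  assumes "X \<in> hypergraphs F" "C \<in> components F X" "f \<in> E X" "v \<in> ends F f" "v \<in> V C"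
  shows "f \<in> E C"
  using component_eq[OF assms(1,2,5)] edge_of_component_of(1)[OF assms(3,4)] assms(5) by metis

lemma component_contains_reachable:
  assumes "X \<in> hypergraphs F" "C \<in> components F X" "v \<in> V C" "(v, w) \<in> (adjacency F X)\<^sup>*"
  shows "w \<in> V C"
  using component_eq[OF assms(1-3)] assms(4) by (metis (lifting) component_of_def hgraph.sel(1) mem_Collect_eq)

lemma hUnion_components:
  assumes X: "X \<in> hypergraphs F"
  shows "hUnion (components F X) = X"
proof (rule subhgraph_antisym)
  show "subhgraph (hUnion (components F X)) X"
    using component_subhgraph by (fastforce simp: subhgraph_def hUnion_def)
  have "\<exists>C\<in>components F X. f \<in> E C" if f: "f \<in> E X" for f
  proof -
    obtain v where v: "v \<in> ends F f" "v \<in> V X"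
      using edge_ends_nonempty[OF X f] edge_ends_subset[OF X f] by blast
    then show ?thesis using ex_component[OF X] component_edge[OF X _ f] by blast
  qed
  then show "subhgraph X (hUnion (components F X))"
    using ex_component[OF X] by (auto simp: subhgraph_def hUnion_def)
qed

lemma hypergraph_eqI:
  assumes "X \<in> hypergraphs F" "Y \<in> hypergraphs F" "components F X = components F Y"
  shows "X = Y"
  using assms hUnion_components by metis

lemma subhgraph_if_components_subset:
  assumes "X \<in> hypergraphs F" "Y \<in> hypergraphs F" "components F Y \<subseteq> components F X"
  shows "subhgraph Y X"
proof -
  have "subhgraph (hUnion (components F Y)) (hUnion (components F X))"
    using assms(3) by (auto simp: subhgraph_def hUnion_def)
  then show ?thesis using assms hUnion_components by metis
qed

text \<open>
  A union of components of \<open>X\<close> is saturated: no hyperedge of \<open>X\<close> crosses its boundary.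
\<close>

lemma edge_in_union_of_components:
  assumes X: "X \<in> hypergraphs F" and Y: "Y \<in> hypergraphs F"
    and sub: "components F Y \<subseteq> components F X"
    and f: "f \<in> E X" "v \<in> ends F f" "v \<in> V Y"
  shows "f \<in> E Y"
proof -
  obtain C where C: "C \<in> components F Y" "v \<in> V C" using ex_component[OF Y f(3)] by blast
  then have "f \<in> E C" using component_edge[OF X _ f(1,2)] sub by blast
  then show ?thesis using component_subhgraph[OF C(1)] by (auto simp: subhgraph_def)
qed

lemma
  assumes X: "X \<in> hypergraphs F" and D: "D \<subseteq> components F X"
  shows hUnion_in_hypergraphs: "hUnion D \<in> hypergraphs F"
    and components_hUnion: "components F (hUnion D) = D"
proof -
  have sub: "subhgraph (hUnion D) X"
    using D component_subhgraph by (fastforce simp: subhgraph_def hUnion_def)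
  show U: "hUnion D \<in> hypergraphs F"
  proof -
    have "ends F f \<subseteq> V (hUnion D)" if f: "f \<in> E (hUnion D)" for f
    proof -
      obtain C where C: "C \<in> D" "f \<in> E C" using f by (auto simp: hUnion_def)
      then have "ends F f \<subseteq> V C" using D components_hypergraphs edge_ends_subset by blast
      then show ?thesis using C by (auto simp: hUnion_def)
    qed
    then show ?thesis using sub X
      by (auto simp: hypergraphs_def subhgraph_def intro: finite_subset)
  qed
  have "D \<subseteq> components F (hUnion D)"
  proof
    fix C assume C: "C \<in> D"
    then have "subhgraph C (hUnion D)" by (auto simp: subhgraph_def hUnion_def)
    moreover have "subhgraph C' X" if "subhgraph C' (hUnion D)" for C'
      using that sub by (auto simp: subhgraph_def)
    ultimately show "C \<in> components F (hUnion D)"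
      using C D unfolding components_def by blast
  qed
  moreover have "C \<in> D" if C: "C \<in> components F (hUnion D)" for C
  proof -
    obtain v where v: "v \<in> V C" using component_vertex[OF C] by blast
    then have "v \<in> V (hUnion D)" using component_subhgraph[OF C] by (auto simp: subhgraph_def)
    then obtain C' where C': "C' \<in> D" "v \<in> V C'" by (auto simp: hUnion_def)
    then have "C = C'"
      using components_unique[OF U C _ v] \<open>D \<subseteq> components F (hUnion D)\<close> by blast
    then show ?thesis using C' by blast
  qed
  ultimately show "components F (hUnion D) = D" by blast
qed

text \<open>
  No hyperedge of \<open>X\<close> outside \<open>Z\<close> touches \<open>V Z\<close>, so the differences form a hypergraph.  It is the only
  possible complement, as a hyperedge is nonempty and cannot lie in two disjoint hypergraphs.
\<close>

lemma direct_diff_eq: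
  assumes X: "X \<in> hypergraphs F" and Z: "Z \<in> hypergraphs F"
    and sub: "components F Z \<subseteq> components F X"
  shows "direct_diff F X Z = HGraph (V X - V Z) (E X - E Z)"
  unfolding direct_diff_def
proof (rule the_equality)
  have ZX: "V Z \<subseteq> V X" "E Z \<subseteq> E X"
    using subhgraph_if_components_subset[OF assms] by (auto simp: subhgraph_def)
  have "ends F f \<inter> V Z = {}" if "f \<in> E X - E Z" for f
    using edge_in_union_of_components[OF assms] that by blast
  then have "HGraph (V X - V Z) (E X - E Z) \<in> hypergraphs F"
    using X by (fastforce simp: hypergraphs_def)
  then show "HGraph (V X - V Z) (E X - E Z) \<in> hypergraphs F \<and>
      vdisjoint (HGraph (V X - V Z) (E X - E Z)) Z \<and>
      X = direct_sum (HGraph (V X - V Z) (E X - E Z)) Z"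
    using ZX by (auto simp: vdisjoint_def direct_sum_def intro!: hgraph.expand)
next
  fix Y assume Y: "Y \<in> hypergraphs F \<and> vdisjoint Y Z \<and> X = direct_sum Y Z"
  have "f \<notin> E Z" if "f \<in> E Y" for f
    using that Y Z edge_ends_nonempty[of Y f] edge_ends_subset[of Y f] edge_ends_subset[of Z f]
    by (auto simp: vdisjoint_def)
  then show "Y = HGraph (V X - V Z) (E X - E Z)"
    using Y by (auto simp: vdisjoint_def direct_sum_def intro!: hgraph.expand)
qed

section \<open>Unions of the components that meet given hyperedges\<close>

lemma
  assumes "X \<in> hypergraphs F"
  shows meet_edges_in_hypergraphs: "meet_edges F X H \<in> hypergraphs F"
    and components_meet_edges:
      "components F (meet_edges F X H) = {C \<in> components F X. \<exists>h\<in>H. ends F h \<inter> V C \<noteq> {}}"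
  unfolding meet_edges_def
  by (rule hUnion_in_hypergraphs[OF assms] components_hUnion[OF assms]; blast)+

lemma components_meet_edges_subset:
  "X \<in> hypergraphs F \<Longrightarrow> components F (meet_edges F X H) \<subseteq> components F X"
  by (auto simp: components_meet_edges)

lemma ends_in_meet_edges:
  assumes X: "X \<in> hypergraphs F" and h: "h \<in> H" "v \<in> ends F h" "v \<in> V X"
  shows "v \<in> V (meet_edges F X H)"
  using ex_component[OF X h(3)] h by (auto simp: meet_edges_def hUnion_def)

lemma eq_meet_edges_iff:
  assumes "X \<in> hypergraphs F"
  shows "X = meet_edges F X H \<longleftrightarrow> (\<forall>C\<in>components F X. \<exists>h\<in>H. ends F h \<inter> V C \<noteq> {})"
proof -
  have "X = meet_edges F X H \<longleftrightarrow> components F X = components F (meet_edges F X H)"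
    using assms meet_edges_in_hypergraphs hypergraph_eqI by metis
  then show ?thesis unfolding components_meet_edges[OF assms] by blast
qed

text \<open>
  This is the source of the rigidity of supports: a hyperedge set whose ends all lie in \<open>Y\<close> can meet
  no component of \<open>X\<close> beyond those of \<open>Y\<close>.
\<close>

lemma eq_meet_edges_if_components_subset:
  assumes X: "X \<in> hypergraphs F" and Y: "Y \<in> hypergraphs F"
    and sub: "components F Y \<subseteq> components F X"
    and meet: "Y = meet_edges F Y H" and ends: "\<And>h. h \<in> H \<Longrightarrow> ends F h \<subseteq> V Y"
  shows "Y = meet_edges F X H"
proof (rule hypergraph_eqI[OF Y meet_edges_in_hypergraphs[OF X]])
  have "C \<in> components F Y"
    if C: "C \<in> components F X" and h: "h \<in> H" "v \<in> ends F h" "v \<in> V C" for C h v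
  proof -
    obtain C' where "C' \<in> components F Y" "v \<in> V C'" using ex_component[OF Y] ends h by blast
    then show ?thesis using components_unique[OF X C] h sub by blast
  qed
  then show "components F Y = components F (meet_edges F X H)"
    using meet sub by (auto simp: components_meet_edges[OF X] eq_meet_edges_iff[OF Y])
qed

section \<open>Adding all available hyperedges from a given set\<close>

text \<open>
  For \<open>A = equiv_edges F R e\<close> these notions are those of equivalent-hyperedges addition, and for
  \<open>A = {h}\<close> those of hyperedge addition; the two facts named \<open>as_available\<close> below record this.
\<close>

definition available :: "'e set \<Rightarrow> ('v, 'e) hgraph \<Rightarrow> 'e set" where
  "available A X = {f \<in> A. ends F f \<subseteq> V X}"

definition addable :: "'e set \<Rightarrow> ('v, 'e) hgraph \<Rightarrow> bool" where
  "addable A X \<longleftrightarrow> available A X \<noteq> {} \<and> available A X \<inter> E X = {}"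

definition add_available :: "'e set \<Rightarrow> ('v, 'e) hgraph \<Rightarrow> ('v, 'e) hgraph" where
  "add_available A X = (if addable A X then boxplus X (available A X) else X)"

definition add_support :: "'e set \<Rightarrow> ('v, 'e) hgraph set \<Rightarrow> ('v, 'e) hgraph set" where
  "add_support A \<X> = {S \<in> \<X>. addable A S \<and> S = meet_edges F S (available A S)}"

definition add_maximal :: "'e set \<Rightarrow> ('v, 'e) hgraph \<Rightarrow> ('v, 'e) hgraph set" where
  "add_maximal A X = (if addable A X then {meet_edges F X (available A X)} else {})"

lemma available_single: "available {h} X = (if ends F h \<subseteq> V X then {h} else {})"
  by (auto simp: available_def)

lemma addable_single_iff: "addable {h} X \<longleftrightarrow> ends F h \<subseteq> V X \<and> h \<notin> E X"
  by (simp add: addable_def available_single)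

lemma edge_addition_as_available:
  shows "edge_add F h = add_available {h}"
    and "edge_add_support F h \<X> = add_support {h} \<X>"
    and "edge_add_maximal F h = add_maximal {h}"
proof -
  show "edge_add F h = add_available {h}"
    by (simp add: fun_eq_iff edge_add_def add_available_def addable_single_iff available_single)
  show "edge_add_maximal F h = add_maximal {h}"
    by (simp add: fun_eq_iff edge_add_maximal_def add_maximal_def addable_single_iff available_single)
  have "ends F h \<subseteq> V T \<and> h \<notin> E T \<and> T = meet_edges F T {h} \<longleftrightarrow>
      addable {h} T \<and> T = meet_edges F T (available {h} T)" for T
    by (simp add: addable_single_iff available_single)
  then show "edge_add_support F h \<X> = add_support {h} \<X>"
    unfolding edge_add_support_def add_support_def by blast
qed

lemma equivalent_edges_as_available:
  shows "equiv_edges_in F R e = available (equiv_edges F R e)"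
    and "equiv_add F R e = add_available (equiv_edges F R e)"
    and "equiv_add_support F R e \<X> = add_support (equiv_edges F R e) \<X>"
    and "equiv_add_maximal F R e = add_maximal (equiv_edges F R e)"
proof -
  show av: "equiv_edges_in F R e = available (equiv_edges F R e)"
    by (intro ext) (simp only: equiv_edges_in_def available_def)
  show "equiv_add F R e = add_available (equiv_edges F R e)"
    by (intro ext) (simp only: av equiv_add_def add_available_def addable_def)
  show "equiv_add_support F R e \<X> = add_support (equiv_edges F R e) \<X>"
    by (simp only: av equiv_add_support_def add_support_def addable_def conj_assoc)
  show "equiv_add_maximal F R e = add_maximal (equiv_edges F R e)"
    by (intro ext) (simp only: av equiv_add_maximal_def add_maximal_def addable_def)
qed

lemma available_meet_edges:
  assumes "X \<in> hypergraphs F"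
  shows "available A (meet_edges F X (available A X)) = available A X"
proof -
  let ?S = "meet_edges F X (available A X)"
  have "V ?S \<subseteq> V X"
    using subhgraph_if_components_subset[OF assms meet_edges_in_hypergraphs[OF assms]
        components_meet_edges_subset[OF assms]] by (simp add: subhgraph_def)
  moreover have "ends F f \<subseteq> V ?S" if "f \<in> available A X" for f
    using ends_in_meet_edges[OF assms that] that by (auto simp: available_def)
  ultimately show ?thesis unfolding available_def by blast
qed

text \<open>
  Restricting an addable hypergraph to the components that meet the available hyperedges keeps all
  of them available, so the restriction is again addable and equals its own restriction.
\<close>

lemma meet_edges_available:
  assumes X: "X \<in> hypergraphs F" and add: "addable A X"
    and S: "S = meet_edges F X (available A X)"
  shows "addable A S" "S = meet_edges F S (available A S)"
proof -
  have av: "available A S = available A X" using available_meet_edges[OF X] S by simp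
  have SF: "S \<in> hypergraphs F" using S meet_edges_in_hypergraphs[OF X] by simp
  have "subhgraph S X"
    using subhgraph_if_components_subset[OF X SF] components_meet_edges_subset[OF X] S by blast
  then show "addable A S" using add av by (auto simp: addable_def subhgraph_def)
  show "S = meet_edges F S (available A S)"
    unfolding av eq_meet_edges_iff[OF SF] unfolding S components_meet_edges[OF X] by blast
qed

lemma add_available_in_hypergraphs:
  assumes X: "X \<in> hypergraphs F" and A: "A \<subseteq> elabels F"
  shows "add_available A X \<in> hypergraphs F"
proof -
  have "finite {f \<in> elabels F. ends F f \<subseteq> V X}"
    using X by (simp add: finite_edges_within hypergraphs_def)
  moreover have "available A X \<subseteq> {f \<in> elabels F. ends F f \<subseteq> V X}"
    using A by (auto simp: available_def)
  ultimately have "finite (available A X)" by (rule rev_finite_subset)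
  then show ?thesis
    using X A by (auto simp: add_available_def boxplus_def hypergraphs_def available_def)
qed

text \<open>
  Maximal subsets have at most one member \<open>S\<close>, which changes without changing its vertex set.  Hence
  the vertex condition for being active is always met, and the required direct sum splits the
  symmetric difference of \<open>E X\<close> and the new hyperedges along \<open>S\<close>.  Amenability enters through
  maximality: a support member contained componentwise in \<open>X\<close> must force \<open>X\<close> to be addable.
\<close>

theorem hypergraph_transformation_add_available:
  assumes A: "A \<subseteq> elabels F" and \<X>: "\<X> \<subseteq> hypergraphs F"
    and closed: "\<And>X. X \<in> \<X> \<Longrightarrow> addable A X \<Longrightarrow> meet_edges F X (available A X) \<in> \<X>"
    and amenable: "\<And>S X. S \<in> add_support A \<X> \<Longrightarrow> X \<in> \<X> \<Longrightarrow>
      components F S \<subseteq> components F X \<Longrightarrow> available A X \<inter> E X = {}"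
  shows "hypergraph_transformation_with F \<X> (add_available A) (add_support A \<X>) (add_maximal A)"
proof -
  let ?S = "add_support A \<X>" and ?p = "add_available A"
  have support: "S \<in> hypergraphs F" "addable A S" "S = meet_edges F S (available A S)"
      "?p S = boxplus S (available A S)" if "S \<in> ?S" for S
    using that \<X> by (auto simp: add_support_def add_available_def)
  have nonredundant: "component_disjoint F S (?p S)" if S: "S \<in> ?S" for S
  proof -
    have False if C: "C \<in> components F S" "C \<in> components F (?p S)" for C
    proof -
      obtain f v where f: "f \<in> available A S" "v \<in> ends F f" "v \<in> V C"
        using C(1) support[OF S] eq_meet_edges_iff[of S "available A S"] by blast
      \<comment> \<open>The added hyperedge \<open>f\<close> touches \<open>C\<close>, so it would belong to \<open>C\<close> and hence to \<open>S\<close>.\<close>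
      have "f \<notin> E S" using f(1) support(2)[OF S] by (auto simp: addable_def)
      then have "f \<in> E (?p S)" using f(1) support(4)[OF S] by (simp add: boxplus_def)
      then have "f \<in> E C"
        using component_edge[OF add_available_in_hypergraphs C(2) _ f(2,3)] support(1)[OF S] A
        by blast
      then show False using \<open>f \<notin> E S\<close> component_subhgraph[OF C(1)] by (auto simp: subhgraph_def)
    qed
    then show ?thesis by (auto simp: component_disjoint_def)
  qed
  have null: "null_hgraph \<notin> ?S"
    using ends_nonempty A by (auto simp: add_support_def addable_def available_def null_hgraph_def)
  have maximal: "maximal_subset F ?S X (add_maximal A X)" if X: "X \<in> \<X>" for X
  proof -
    have XF: "X \<in> hypergraphs F" using X \<X> by blast
    have mem: "add_maximal A X \<subseteq> ?S"
      using closed[OF X] meet_edges_available[OF XF]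
      by (auto simp: add_maximal_def add_support_def)
    have "\<exists>T\<in>add_maximal A X. components F Y \<subseteq> components F T"
      if Y: "Y \<in> ?S" and sub: "components F Y \<subseteq> components F X" for Y
    proof -
      have "available A Y \<subseteq> available A X"
        using subhgraph_if_components_subset[OF XF support(1)[OF Y] sub]
        by (auto simp: available_def subhgraph_def)
      moreover from this have "addable A X"
        using amenable[OF Y X sub] support(2)[OF Y] by (auto simp: addable_def)
      moreover have "\<exists>f\<in>available A Y. ends F f \<inter> V C \<noteq> {}" if "C \<in> components F Y" for C
        using that support[OF Y] eq_meet_edges_iff by blast
      ultimately show ?thesis
        using sub by (fastforce simp: add_maximal_def components_meet_edges[OF XF])
    qed
    moreover have "components F T \<subseteq> components F X" if "T \<in> add_maximal A X" for T
      using that components_meet_edges_subset[OF XF] by (auto simp: add_maximal_def split: if_splits)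
    moreover have "pairwise (component_disjoint F) (add_maximal A X)"
      by (simp add: add_maximal_def pairwise_def)
    ultimately show ?thesis using mem null by (auto simp: maximal_subset_def)
  qed
  have decomposition: "pairwise vdisjoint (?p ` active F ?p (add_maximal A) X) \<and>
        card (?p ` active F ?p (add_maximal A) X) = card (active F ?p (add_maximal A) X) \<and>
        ?p X = direct_sum (direct_diff F X (hUnion (active F ?p (add_maximal A) X)))
                         (hUnion (?p ` active F ?p (add_maximal A) X))" if X: "X \<in> \<X>" for X
  proof (cases "addable A X")
    case False
    have XF: "X \<in> hypergraphs F" using X \<X> by blast
    have none: "active F ?p (add_maximal A) X = {}"
      using False by (simp add: active_def add_maximal_def)
    have "components F (hUnion {}) = {}" "hUnion {} \<in> hypergraphs F"
      using components_hUnion[OF XF] hUnion_in_hypergraphs[OF XF] by auto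
    then have "direct_diff F X (hUnion {}) = HGraph (V X) (E X)"
      using direct_diff_eq[OF XF, of "hUnion {}"] by (simp add: hUnion_def)
    then show ?thesis
      using False by (simp add: none hUnion_def direct_sum_def add_available_def)
  next
    case True
    define S where "S = meet_edges F X (available A X)"
    have XF: "X \<in> hypergraphs F" using X \<X> by blast
    have S: "S \<in> hypergraphs F" "components F S \<subseteq> components F X"
      using meet_edges_in_hypergraphs[OF XF] components_meet_edges_subset[OF XF]
      by (auto simp: S_def)
    have av: "available A S = available A X" unfolding S_def by (rule available_meet_edges[OF XF])
    have pS: "?p S = boxplus S (available A X)"
      using meet_edges_available(1)[OF XF True S_def] av by (simp add: add_available_def)
    have diff: "direct_diff F X S = HGraph (V X - V S) (E X - E S)"
      by (rule direct_diff_eq[OF XF S])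
    have active: "active F ?p (add_maximal A) X = {S}"
      using True diff by (auto simp: active_def add_maximal_def S_def[symmetric] pS boxplus_def)
    have sub: "subhgraph S X" by (rule subhgraph_if_components_subset[OF XF S])
    have disj: "available A X \<inter> E X = {}" using True by (simp add: addable_def)
    have "sym_diff (E X) (available A X) = (E X - E S) \<union> sym_diff (E S) (available A X)"
      using sub disj unfolding subhgraph_def by blast
    moreover have "V X = (V X - V S) \<union> V S" using sub by (auto simp: subhgraph_def)
    moreover have "?p X = boxplus X (available A X)" using True by (simp add: add_available_def)
    ultimately have "?p X = direct_sum (direct_diff F X S) (?p S)"
      unfolding pS diff by (simp only: boxplus_def direct_sum_def hgraph.sel)
    moreover have "hUnion {S} = S" "hUnion {?p S} = ?p S" by (simp_all add: hUnion_def)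
    ultimately show ?thesis by (simp add: active)
  qed
  have "?p ` \<X> \<subseteq> hypergraphs F" using add_available_in_hypergraphs[OF _ A] \<X> by blast
  moreover have "?S \<subseteq> \<X>" by (auto simp: add_support_def)
  ultimately show ?thesis
    unfolding hypergraph_transformation_with_def
    using \<X> nonredundant null maximal decomposition by blast
qed

end

text \<open>
  Transformations and families of maximal subsets matter on the domain only.  This transfers results
  to the maps \<open>quot_map\<close> and \<open>quot_maximal\<close>, which are defined through chosen preimages.
\<close>

lemma hypergraph_transformation_with_cong:
  assumes T: "hypergraph_transformation_with F \<X> p S D"
    and p: "\<And>X. X \<in> \<X> \<Longrightarrow> p' X = p X" and D: "\<And>X. X \<in> \<X> \<Longrightarrow> D' X = D X"
  shows "hypergraph_transformation_with F \<X> p' S D'"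
proof -
  have S: "S \<subseteq> \<X>" using T by (simp add: hypergraph_transformation_with_def)
  have DX: "D X \<subseteq> \<X>" if "X \<in> \<X>" for X
    using T S that unfolding hypergraph_transformation_with_def maximal_subset_def
    by (meson order_trans)
  have active: "active F p' D' X = active F p D X" if "X \<in> \<X>" for X
    unfolding active_def D[OF that] using DX[OF that] p by (intro Collect_cong) (metis subsetD)
  have "p' ` active F p D X = p ` active F p D X" if "X \<in> \<X>" for X
    using DX[OF that] p by (intro image_cong) (auto simp: active_def)
  moreover have "p' ` \<X> = p ` \<X>" using p by (intro image_cong) auto
  ultimately show ?thesis
    using T S p D by (auto simp: hypergraph_transformation_with_def active subset_iff)
qed

section \<open>Quotient hypergraphs\<close>

locale quotient_family = hyperfamily F for F :: "('v, 'e) hfam" +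
  fixes R :: "('v \<times> 'v) set"
  assumes equiv_R: "equiv (vlabels F) R"
begin

sublocale Q: hyperfamily "quot_family F R"
  by unfold_locales (rule hypergraph_family_quot[OF family])

lemma quot_in_hypergraphs: "X \<in> hypergraphs F \<Longrightarrow> quot F R X \<in> hypergraphs (quot_family F R)"
  using hypergraphs_quot_family[OF family equiv_R] by blast

lemma V_quot: "V (quot F R X) = (\<lambda>v. R `` {v}) ` V X"
  by (simp add: quot_def quot_eq_image)

lemma E_quot:
  assumes X: "X \<in> hypergraphs F"
  shows "E (quot F R X) = edge_quot F R ` E X \<inter> elabels (quot_family F R)"
proof -
  have "(\<forall>a\<in>A. ends F f \<inter> a \<noteq> {}) \<and> ends F f \<subseteq> \<Union>A \<longleftrightarrow> A = edge_quot F R f"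
    if "f \<in> E X" "A \<in> edge_sets (vlabels F // R) (loops F)" for f A
    using that X by (intro edges_quot_iff[OF equiv_R]) (fastforce simp: hypergraphs_def edge_sets_def)+
  then show ?thesis by (auto simp: quot_def quot_family_def)
qed

text \<open>
  When loops are disallowed, a hyperedge whose ends all lie in one class leaves no trace in the
  quotient, but then the step along it stays at one vertex of the quotient.
\<close>

lemma reachable_quot:
  assumes X: "X \<in> hypergraphs F" and "(u, v) \<in> (adjacency F X)\<^sup>*"
  shows "(R `` {u}, R `` {v}) \<in> (adjacency (quot_family F R) (quot F R X))\<^sup>*"
  using assms(2)
proof (induction rule: rtrancl_induct)
  case (step v w)
  then obtain f where f: "f \<in> E X" "v \<in> ends F f" "w \<in> ends F f" by (auto simp: adjacency_def)
  have "ends F f \<subseteq> V X" "V X \<subseteq> vlabels F" "finite (V X)"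
    using f(1) X by (auto simp: hypergraphs_def)
  then have fin: "finite (edge_quot F R f)" and sub: "edge_quot F R f \<subseteq> vlabels F // R"
    by (auto simp: edge_quot_def quot_eq_image intro: finite_subset)
  have mem: "R `` {v} \<in> edge_quot F R f" "R `` {w} \<in> edge_quot F R f"
    using f by (auto simp: edge_quot_def quot_eq_image)
  have "(R `` {v}, R `` {w}) \<in> (adjacency (quot_family F R) (quot F R X))\<^sup>*"
  proof (cases "edge_quot F R f \<in> elabels (quot_family F R)")
    case True
    then have "edge_quot F R f \<in> E (quot F R X)" using E_quot[OF X] f(1) by blast
    then have "(R `` {v}, R `` {w}) \<in> adjacency (quot_family F R) (quot F R X)"
      using mem by (auto simp: adjacency_def quot_family_def)
    then show ?thesis by blast
  next
    case False
    then have "card (edge_quot F R f) \<le> Suc 0"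
      using fin sub mem by (auto simp: quot_family_def edge_sets_def)
    then have "R `` {v} = R `` {w}" using mem fin by (metis card_le_Suc0_iff_eq)
    then show ?thesis by simp
  qed
  then show ?case using step.IH by simp
qed simp

end

section \<open>Equivalent hyperedges and their common quotient\<close>

locale equivalent_edges = quotient_family F R for F :: "('v, 'e) hfam" and R +
  fixes e :: 'e
  assumes edge_quot_e: "edge_quot F R e \<in> elabels (quot_family F R)"
begin

abbreviation "\<A> \<equiv> equiv_edges F R e"
abbreviation "h \<equiv> edge_quot F R e"
abbreviation "Q \<equiv> quot_family F R"

lemma equiv_edges_elabels: "\<A> \<subseteq> elabels F"
  by (auto simp: equiv_edges_def)

lemma ends_h: "ends Q h = h" and h_nonempty: "h \<noteq> {}"
  using edge_quot_e by (auto simp: quot_family_def edge_sets_def)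

lemma edge_quot_available: "f \<in> available \<A> X \<Longrightarrow> edge_quot F R f = h \<and> ends F f \<subseteq> V X"
  by (simp add: available_def equiv_edges_def)

text \<open>
  Choosing one representative in \<open>W\<close> of each class in \<open>h\<close> gives a vertex set of the same cardinality,
  which is therefore admissible as the set of ends of a hyperedge even if loops are disallowed.
\<close>

lemma edge_with_ends_in:
  assumes W: "W \<subseteq> vlabels F" and h: "h \<subseteq> (\<lambda>v. R `` {v}) ` W"
  shows "\<exists>f\<in>\<A>. ends F f \<subseteq> W"
proof -
  obtain s where s: "\<And>a. a \<in> h \<Longrightarrow> s a \<in> W \<and> R `` {s a} = a"
    using h by (metis (no_types, lifting) image_iff subsetD)
  have "inj_on s h" using s by (metis inj_onI)
  then have "s ` h \<in> edge_sets (vlabels F) (loops F)"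
    using edge_quot_e s W by (auto simp: quot_family_def edge_sets_def card_image)
  then obtain f where f: "f \<in> elabels F" "ends F f = s ` h"
    using family unfolding hypergraph_family_def by blast
  have "edge_quot F R f = h"
    using s f(2) by (force simp: edge_quot_def quot_eq_image image_image)
  moreover have "ends F f \<subseteq> W" using f(2) s by auto
  ultimately show ?thesis using f(1) by (auto simp: equiv_edges_def)
qed

lemma available_nonempty_iff:
  assumes X: "X \<in> hypergraphs F"
  shows "available \<A> X \<noteq> {} \<longleftrightarrow> h \<subseteq> V (quot F R X)"
proof
  assume "available \<A> X \<noteq> {}"
  then obtain f where "edge_quot F R f = h" "ends F f \<subseteq> V X" using edge_quot_available by blast
  then show "h \<subseteq> V (quot F R X)"
    unfolding V_quot edge_quot_def quot_eq_image by (metis image_mono)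
next
  assume "h \<subseteq> V (quot F R X)"
  then show "available \<A> X \<noteq> {}"
    using edge_with_ends_in[of "V X"] X by (auto simp: V_quot available_def hypergraphs_def)
qed

lemma available_present_iff:
  assumes X: "X \<in> hypergraphs F"
  shows "available \<A> X \<inter> E X \<noteq> {} \<longleftrightarrow> h \<in> E (quot F R X)"
proof -
  have "available \<A> X \<inter> E X = {f \<in> E X. edge_quot F R f = h}"
    using X by (auto simp: available_def equiv_edges_def hypergraphs_def)
  then show ?thesis using edge_quot_e by (auto simp: E_quot[OF X])
qed

lemma Q_addable_iff: "Q.addable {h} T \<longleftrightarrow> h \<subseteq> V T \<and> h \<notin> E T"
  by (simp add: Q.addable_single_iff ends_h)

lemma Q_available: "h \<subseteq> V T \<Longrightarrow> Q.available {h} T = {h}"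
  by (simp add: Q.available_single ends_h)

lemma addable_quot_iff:
  "X \<in> hypergraphs F \<Longrightarrow> Q.addable {h} (quot F R X) \<longleftrightarrow> addable \<A> X"
  using available_nonempty_iff available_present_iff
  by (auto simp: Q_addable_iff addable_def)

text \<open>
  All hyperedges added to an addable \<open>X\<close> have the same quotient \<open>h\<close>, and there is at least one.
\<close>

lemma quot_add_available:
  assumes X: "X \<in> hypergraphs F"
  shows "quot F R (add_available \<A> X) = Q.add_available {h} (quot F R X)"
proof (cases "addable \<A> X")
  case True
  let ?X' = "add_available \<A> X"
  have X': "?X' \<in> hypergraphs F" by (rule add_available_in_hypergraphs[OF X equiv_edges_elabels])
  have add: "h \<subseteq> V (quot F R X)" "h \<notin> E (quot F R X)"
    using True addable_quot_iff[OF X] Q_addable_iff by auto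
  have "E ?X' = E X \<union> available \<A> X"
    using True by (auto simp: add_available_def boxplus_def addable_def)
  moreover have "edge_quot F R ` available \<A> X = {h}"
    using True edge_quot_available by (auto simp: addable_def)
  ultimately have "E (quot F R ?X') = E (quot F R X) \<union> {h}"
    using edge_quot_e by (simp add: E_quot[OF X] E_quot[OF X'] image_Un Int_Un_distrib2)
  moreover have "V (quot F R ?X') = V (quot F R X)"
    using True by (simp add: V_quot add_available_def boxplus_def)
  ultimately show ?thesis
    using add by (auto simp: Q.add_available_def Q_addable_iff boxplus_def Q_available
        intro!: hgraph.expand)
next
  case False
  then show ?thesis
    using addable_quot_iff[OF X] by (simp add: add_available_def Q.add_available_def)
qed

text \<open>
  Each vertex of \<open>S\<close> is joined to an end of some available hyperedge; the image of such a path joins its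
  class to a vertex of \<open>h\<close>.
\<close>

lemma quot_eq_meet_edges:
  assumes S: "S \<in> hypergraphs F" and meet: "S = meet_edges F S (available \<A> S)"
  shows "quot F R S = meet_edges Q (quot F R S) {h}"
proof -
  have "h \<inter> V C \<noteq> {}" if C: "C \<in> components Q (quot F R S)" for C
  proof -
    obtain a where "a \<in> V C" "a \<in> V (quot F R S)"
      using Q.component_vertex[OF C] Q.component_subhgraph[OF C] by (auto simp: subhgraph_def)
    then obtain v where v: "v \<in> V S" "R `` {v} \<in> V C" by (auto simp: V_quot)
    then have "component_of S v \<in> components F S" by (simp add: components_eq[OF S])
    then obtain f u where f: "f \<in> available \<A> S" "u \<in> ends F f" "u \<in> V (component_of S v)"
      using meet eq_meet_edges_iff[OF S] by blast
    have "R `` {u} \<in> V C"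
      using Q.component_contains_reachable[OF quot_in_hypergraphs[OF S] C v(2)]
        reachable_quot[OF S] f(3) by (simp add: component_of_def)
    moreover have "R `` {u} \<in> edge_quot F R f"
      using f(2) by (auto simp: edge_quot_def quot_eq_image)
    ultimately show ?thesis using edge_quot_available[OF f(1)] by auto
  qed
  then show ?thesis by (simp add: Q.eq_meet_edges_iff[OF quot_in_hypergraphs[OF S]] ends_h)
qed

lemma quot_add_support:
  assumes \<X>: "\<X> \<subseteq> hypergraphs F"
  shows "quot F R ` add_support \<A> \<X> \<subseteq> Q.add_support {h} (quot F R ` \<X>)"
proof -
  have "quot F R S \<in> Q.add_support {h} (quot F R ` \<X>)" if "S \<in> add_support \<A> \<X>" for S
  proof -
    have S: "S \<in> \<X>" "S \<in> hypergraphs F" "addable \<A> S" "S = meet_edges F S (available \<A> S)"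
      using that \<X> by (auto simp: add_support_def)
    then have "Q.addable {h} (quot F R S)" using addable_quot_iff by blast
    then show ?thesis
      using S quot_eq_meet_edges[OF S(2,4)]
      by (auto simp: Q.add_support_def Q_available Q_addable_iff)
  qed
  then show ?thesis by blast
qed

text \<open>
  Rigidity of supports in the quotient.  All vertices of \<open>h\<close> lie in \<open>Y\<close>, so the components of \<open>T\<close> that
  meet \<open>h\<close> are components of \<open>Y\<close>, and a hyperedge \<open>h\<close> of \<open>T\<close> would be one of \<open>Y\<close>.
\<close>

lemma Q_add_support_rigid:
  assumes \<Y>: "\<Y> \<subseteq> hypergraphs Q" and Y: "Y \<in> Q.add_support {h} \<Y>"
    and T: "T \<in> hypergraphs Q" and sub: "components Q Y \<subseteq> components Q T"
  shows "Y = meet_edges Q T {h}" "h \<notin> E T"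
proof -
  have YF: "Y \<in> hypergraphs Q" and h: "h \<subseteq> V Y" "h \<notin> E Y"
    and meet: "Y = meet_edges Q Y {h}"
    using Y \<Y> Q_available[of Y] by (auto simp: Q.add_support_def Q_addable_iff)
  show "Y = meet_edges Q T {h}"
    using h by (intro Q.eq_meet_edges_if_components_subset[OF T YF sub meet]) (simp add: ends_h)
  show "h \<notin> E T"
    using Q.edge_in_union_of_components[OF T YF sub, of h] h h_nonempty ends_h by blast
qed

text \<open>
  The condition on larger support members is met because there are no properly larger ones: both
  equal the union of the components of the larger one that meet \<open>h\<close>.
\<close>

theorem upward_closed_quot_support:
  assumes \<X>: "\<X> \<subseteq> hypergraphs F"
  shows "upward_closed Q (quot F R ` add_support \<A> \<X>) (Q.add_support {h} (quot F R ` \<X>))"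
proof -
  have \<Y>: "quot F R ` \<X> \<subseteq> hypergraphs Q" using \<X> quot_in_hypergraphs by blast
  have "T = Y"
    if Y: "Y \<in> quot F R ` add_support \<A> \<X>" and T: "T \<in> Q.add_support {h} (quot F R ` \<X>)"
      and sub: "components Q Y \<subseteq> components Q T" for Y T
  proof -
    have TF: "T \<in> hypergraphs Q" using T \<Y> by (auto simp: Q.add_support_def)
    have "Y \<in> Q.add_support {h} (quot F R ` \<X>)" using Y quot_add_support[OF \<X>] by blast
    then have "Y = meet_edges Q T {h}" by (rule Q_add_support_rigid(1)[OF \<Y> _ TF sub])
    moreover have "T = meet_edges Q T {h}" by (rule Q_add_support_rigid(1)[OF \<Y> T TF order_refl])
    ultimately show ?thesis by simp
  qed
  then show ?thesis using quot_add_support[OF \<X>] by (auto simp: upward_closed_def)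
qed

section \<open>Domains whose components are preserved by the quotient\<close>

context
  fixes \<X> :: "('v, 'e) hgraph set"
  assumes \<X>: "\<X> \<subseteq> hypergraphs F"
    and closed: "\<And>X. X \<in> \<X> \<Longrightarrow> addable \<A> X \<Longrightarrow> meet_edges F X (available \<A> X) \<in> \<X>"
    and preserving: "preserving F R (add_support \<A> \<X>) \<X>"
begin

lemma meet_edges_in_support:
  "X \<in> \<X> \<Longrightarrow> addable \<A> X \<Longrightarrow> meet_edges F X (available \<A> X) \<in> add_support \<A> \<X>"
  using closed meet_edges_available \<X> by (auto simp: add_support_def)

text \<open>
  Preservation places the components of the quotient of a support member among those of \<open>X//R\<close>, and
  rigidity does the rest.
\<close>

lemma quot_meet_edges:
  assumes X: "X \<in> \<X>" and add: "addable \<A> X"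
  shows "quot F R (meet_edges F X (available \<A> X)) = meet_edges Q (quot F R X) {h}"
proof (rule Q_add_support_rigid(1)[of "quot F R ` \<X>"])
  show "quot F R ` \<X> \<subseteq> hypergraphs Q" "quot F R X \<in> hypergraphs Q"
    using \<X> X quot_in_hypergraphs by blast+
  show "quot F R (meet_edges F X (available \<A> X)) \<in> Q.add_support {h} (quot F R ` \<X>)"
    using meet_edges_in_support[OF X add] quot_add_support[OF \<X>] by blast
  show "components Q (quot F R (meet_edges F X (available \<A> X))) \<subseteq> components Q (quot F R X)"
    using preserving meet_edges_in_support[OF X add] components_meet_edges_subset \<X> X
    unfolding preserving_def by blast
qed

lemma quot_add_maximal:
  assumes X: "X \<in> \<X>"
  shows "quot F R ` add_maximal \<A> X = Q.add_maximal {h} (quot F R X)"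
proof -
  have "Q.addable {h} (quot F R X) \<longleftrightarrow> addable \<A> X" using addable_quot_iff X \<X> by blast
  moreover from this have "Q.available {h} (quot F R X) = {h}" if "addable \<A> X"
    using that Q_available Q_addable_iff by blast
  ultimately show ?thesis
    using quot_meet_edges[OF X] by (simp add: add_maximal_def Q.add_maximal_def)
qed

text \<open>
  A member \<open>T = X//R\<close> of the support in the quotient need not come from a support member \<open>X\<close>, but
  restricting \<open>X\<close> to the components that meet the available hyperedges yields one with the same
  quotient.
\<close>

lemma quot_support_eq: "quot F R ` add_support \<A> \<X> = Q.add_support {h} (quot F R ` \<X>)"
proof (intro equalityI subsetI)
  fix T assume T: "T \<in> Q.add_support {h} (quot F R ` \<X>)"
  then obtain X where X: "X \<in> \<X>" "T = quot F R X" by (auto simp: Q.add_support_def)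
  have "Q.addable {h} T" "T = meet_edges Q T {h}"
    using T Q_available[of T] by (auto simp: Q.add_support_def Q_addable_iff)
  moreover from this have "addable \<A> X" using addable_quot_iff X \<X> by blast
  ultimately show "T \<in> quot F R ` add_support \<A> \<X>"
    using quot_meet_edges[OF X(1)] meet_edges_in_support[OF X(1)] X(2) by (metis imageI)
qed (use quot_add_support[OF \<X>] in blast)

text \<open>
  Closedness descends from \<open>\<X>\<close> because restriction to the components that meet the new hyperedges
  commutes with the quotient; amenability is the second half of rigidity.
\<close>

theorem hypergraph_transformation_quot:
  "hypergraph_transformation_with Q (quot F R ` \<X>) (Q.add_available {h})
     (Q.add_support {h} (quot F R ` \<X>)) (Q.add_maximal {h})"
proof (rule Q.hypergraph_transformation_add_available)
  show "{h} \<subseteq> elabels Q" using edge_quot_e by simp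
  show \<Y>: "quot F R ` \<X> \<subseteq> hypergraphs Q" using \<X> quot_in_hypergraphs by blast
  show "meet_edges Q Y (Q.available {h} Y) \<in> quot F R ` \<X>"
    if "Y \<in> quot F R ` \<X>" "Q.addable {h} Y" for Y
  proof -
    obtain X where X: "X \<in> \<X>" "Y = quot F R X" using \<open>Y \<in> quot F R ` \<X>\<close> by blast
    have "addable \<A> X" using addable_quot_iff X \<X> that(2) by blast
    moreover have "Q.available {h} Y = {h}" using that(2) Q_available Q_addable_iff by blast
    ultimately show ?thesis using quot_meet_edges[OF X(1)] closed[OF X(1)] X(2) by (metis imageI)
  qed
  show "Q.available {h} Y \<inter> E Y = {}"
    if "S \<in> Q.add_support {h} (quot F R ` \<X>)" "Y \<in> quot F R ` \<X>"
      "components Q S \<subseteq> components Q Y" for S Y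
    using Q_add_support_rigid(2)[OF \<Y> that(1) _ that(3)] that(2) \<Y>
    by (auto simp: Q.available_def)
qed

lemma quot_map_add_available:
  assumes "Y \<in> quot F R ` \<X>"
  shows "quot_map F R \<X> (add_available \<A>) Y = Q.add_available {h} Y"
  using quot_add_available \<X> inv_into_into[OF assms] f_inv_into_f[OF assms]
  by (auto simp: quot_map_def)

lemma quot_maximal_add_maximal:
  assumes "Y \<in> quot F R ` \<X>"
  shows "quot_maximal F R \<X> (add_maximal \<A>) Y = Q.add_maximal {h} Y"
  using quot_add_maximal[OF inv_into_into[OF assms]] f_inv_into_f[OF assms]
  by (simp add: quot_maximal_def)

lemma hypergraph_transformation_quot_map:
  "hypergraph_transformation_with Q (quot F R ` \<X>) (quot_map F R \<X> (add_available \<A>))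
     (quot F R ` add_support \<A> \<X>) (quot_maximal F R \<X> (add_maximal \<A>))"
  unfolding quot_support_eq
  by (rule hypergraph_transformation_with_cong[OF hypergraph_transformation_quot])
    (simp_all add: quot_map_add_available quot_maximal_add_maximal)

theorem amenable_add_available:
  assumes "hypergraph_transformation_with F \<X> (add_available \<A>) (add_support \<A> \<X>) (add_maximal \<A>)"
  shows "amenable F R \<X> (add_available \<A>) (add_support \<A> \<X>) (add_maximal \<A>)"
proof -
  have "quot F R (add_available \<A> X) = quot F R (add_available \<A> X')"
    "quot F R ` add_maximal \<A> X = quot F R ` add_maximal \<A> X'"
    if "X \<in> \<X>" "X' \<in> \<X>" "quot F R X = quot F R X'" for X X'
    using that \<X> quot_add_available quot_add_maximal by (metis subsetD)+
  then show ?thesis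
    unfolding amenable_def using equiv_R assms hypergraph_transformation_quot_map by blast
qed

theorem support_reduction_quot:
  "support_reduction Q (quot F R ` \<X>) (quot_map F R \<X> (add_available \<A>))
     (quot F R ` add_support \<A> \<X>) (Q.add_available {h}) (Q.add_support {h} (quot F R ` \<X>))"
proof -
  have "hypergraph_transformation Q (quot F R ` \<X>) (quot_map F R \<X> (add_available \<A>))
      (quot F R ` add_support \<A> \<X>)"
    using hypergraph_transformation_quot_map unfolding hypergraph_transformation_def by blast
  moreover have "hypergraph_transformation Q (quot F R ` \<X>) (Q.add_available {h})
      (Q.add_support {h} (quot F R ` \<X>))"
    using hypergraph_transformation_quot unfolding hypergraph_transformation_def by blast
  moreover have "add_support \<A> \<X> \<subseteq> \<X>" by (auto simp: add_support_def)
  ultimately show ?thesis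
    using upward_closed_quot_support[OF \<X>] quot_map_add_available
    unfolding support_reduction_def by blast
qed

end

end

theorem proposition4p13:
  fixes F :: "('v, 'e) hfam" and R :: "('v \<times> 'v) set" and e :: 'e
    and \<X> :: "('v, 'e) hgraph set"
  assumes "hypergraph_family F"
    and "equiv (vlabels F) R"
    and "e \<in> elabels F"
    and "edge_quot F R e \<in> elabels (quot_family F R)"
    and "\<X> \<subseteq> hypergraphs F"
    and "closed_for_addition F R e \<X>"
    and "amenable_for_addition F R e \<X>"
  shows
    "hypergraph_transformation_with F \<X> (equiv_add F R e)
       (equiv_add_support F R e \<X>) (equiv_add_maximal F R e) \<and>
     (preserving F R (equiv_add_support F R e \<X>) \<X> \<longrightarrow>
      edge_addition_transformation_with (quot_family F R) (edge_quot F R e) (quot F R ` \<X>)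
       (edge_add (quot_family F R) (edge_quot F R e))
       (edge_add_support (quot_family F R) (edge_quot F R e) (quot F R ` \<X>))
       (edge_add_maximal (quot_family F R) (edge_quot F R e))) \<and>
     upward_closed (quot_family F R) (quot F R ` equiv_add_support F R e \<X>)
       (edge_add_support (quot_family F R) (edge_quot F R e) (quot F R ` \<X>)) \<and>
     (preserving F R (equiv_add_support F R e \<X>) \<X> \<longrightarrow>
     amenable F R \<X> (equiv_add F R e) (equiv_add_support F R e \<X>) (equiv_add_maximal F R e) \<and>
     support_reduction (quot_family F R) (quot F R ` \<X>)
       (quot_map F R \<X> (equiv_add F R e)) (quot F R ` equiv_add_support F R e \<X>)
       (edge_add (quot_family F R) (edge_quot F R e))
       (edge_add_support (quot_family F R) (edge_quot F R e) (quot F R ` \<X>)))"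
proof -
  interpret equivalent_edges F R e
    using assms by unfold_locales
  \<comment> \<open>Both additions become instances of adding available hyperedges, for \<open>\<A>\<close> and for \<open>{h}\<close>.\<close>
  note rewrite = equivalent_edges_as_available Q.edge_addition_as_available
  have closed: "meet_edges F X (available \<A> X) \<in> \<X>" if "X \<in> \<X>" "addable \<A> X" for X
    using assms(6) that by (auto simp: closed_for_addition_def rewrite addable_def)
  have amenable: "available \<A> X \<inter> E X = {}"
    if "S \<in> add_support \<A> \<X>" "X \<in> \<X>" "components F S \<subseteq> components F X" for S X
    using assms(7) that
    unfolding amenable_for_addition_def rewrite add_support_def addable_def by blast
  have add: "hypergraph_transformation_with F \<X> (add_available \<A>) (add_support \<A> \<X>)
      (add_maximal \<A>)"
    using hypergraph_transformation_add_available[OF equiv_edges_elabels assms(5)] closed amenable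
    by blast
  have "edge_addition_transformation_with Q h (quot F R ` \<X>) (Q.add_available {h})
      (Q.add_support {h} (quot F R ` \<X>)) (Q.add_maximal {h})"
    if "preserving F R (add_support \<A> \<X>) \<X>"
    using hypergraph_transformation_quot[OF assms(5) closed that] edge_quot_e
    by (simp add: edge_addition_transformation_with_def rewrite)
  then show ?thesis
    unfolding rewrite
    using add upward_closed_quot_support[OF assms(5)] amenable_add_available[OF assms(5) closed]
      support_reduction_quot[OF assms(5) closed]
    by blast
qed

end
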